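(* Every $\text{PCTL}_{\mathit{alive}}$-formula is an absolute liveness property, and for every PCTL formula $\Phi$ that is an absolute liveness property there exists $\Phi'\in\text{PCTL}_{\mathit{alive}}$ with $\Phi\equiv\Phi'$.
   Context: Fix a finite non-empty set $\mathit{AP}$. A probabilistic tree (PT) is $T=(W,L,P)$ with $\epsilon\notin W$, $W\cup\{\epsilon\}\subseteq\mathbb{N}^*$ prefix-closed, $L:W\to\mathcal{P}(\mathit{AP})$, and $P$ a partial function from $W$ to distributions over $W$ with $P(\pi)(\pi')>0$ iff $\pi'=\pi\cdot n\in W$ for some $n$. $T$ is total if every node is a proper prefix of some node; $\mathbb{T}^\omega$ is the set of total PTs; a property is a subset of $\mathbb{T}^\omega$. Suffix: $T_2$ is a suffix of $T_1$ iff there is $\pi_1\in W_1$ with $\{\pi_1\cdot\pi_2\mid\pi_2\in W_2\}\subseteq W_1$, $L_2(\pi_2)=L_1(\pi_1\cdot\pi_2)$ for all $\pi_2\in W_2$, and $P_2(\pi_2,\pi'_2)=P_1(\pi_1\cdot\pi_2,\pi_1\cdot\pi'_2)$ for all $\pi_2,\pi'_2\in W_2$. $P$ is an absolute liveness property iff $P\ne\emptyset$ and for all $T,T'\in\mathbb{T}^\omega$: if $T'\in P$ and $T'$ is a suffix of $T$ then $T\in P$. A Markov chain (MC) is $\mathsf{D}=(S,\mathit{AP},\to,L,s_0)$ with $S\subseteq\mathbb{N}$ countable, $\to:S\to\mathit{Dist}(S)$ total, $L:S\to\mathcal{P}(\mathit{AP})$, initial state $s_0$. Its unfolding $T(\mathsf{D})$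 has as nodes the least set of state sequences containing $s_0$ and closed under appending a state $t$ with $\mu(t)>0$ where $\mathrm{last}(\pi)\to\mu$; labels $L(\mathrm{last}(\pi))$; edge probabilities $P(\pi,\pi')=\mu(\mathrm{last}(\pi'))$ with $\mathrm{last}(\pi)\to\mu$. PCTL: state formulas $\Phi::=a\mid\Phi_1\land\Phi_2\mid\neg\Phi\mid\mathbb{P}_{\bowtie q}(\varphi)$, path formulas $\varphi::=\mathsf{X}\Phi\mid\Phi_1\mathsf{U}\Phi_2\mid\Phi_1\mathsf{W}\Phi_2$, $\bowtie\in\{<,>,\le,\ge\}$, $q\in[0,1]$, standard semantics on MCs ($\pi\models\Phi_1\mathsf{W}\Phi_2$ iff $\pi\models\Phi_1\mathsf{U}\Phi_2$ or all states of $\pi$ satisfy $\Phi_1$); positive normal form; $\top=a\lor\neg a$, $\bot=\neg\top$. $P_\Phi=\{T(\mathsf{D})\mid\mathsf{D}\models\Phi\}$ ($\mathsf{D}\models\Phi$ iff the initial state satisfies $\Phi$); $\Phi$ is an absolute liveness property iff $P_\Phi$ is; $\Phi\equiv\Psi$ iff $P_\Phi=P_\Psi$. $\text{PCTL}_{\mathit{alive}}$ is the smallest set $\mathcal{F}$ of PCTL formulas such that: (1) $\top\in\mathcal{F}$ and $\bot\notin\mathcal{F}$ (no formula equivalent to $\bot$ belongs to $\mathcal{F}$); (2) if $\Phi_1,\Phi_2\in\mathcal{F}$ then $\Phi_1\land\Phi_2$, $\Phi_1\lor\Phi_2$, $\mathbb{P}_{>0}(\Phi_1\mathsf{W}\Phi_2)\in\mathcal{F}$;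 (3) if $\Phi_2\in\mathcal{F}$ then $\mathbb{P}_{>0}(\mathsf{X}\Phi_2)$ and $\mathbb{P}_{>0}(\Phi_1\mathsf{U}\Phi_2)\in\mathcal{F}$ (for any $\Phi_1$); (4) if $\Phi_1\in\mathcal{F}$ and $\neg\Phi_1\land\Phi_2\equiv\bot$ then $\mathbb{P}_{>0}(\Phi_1\mathsf{U}\Phi_2)$, $\mathbb{P}_{>0}(\Phi_1\mathsf{W}\Phi_2)\in\mathcal{F}$.
   Formalization: Trees have exactly one root; P_Φ is taken up to tree isomorphism with unfoldings (with literal equality or several roots, even ⊤ fails to be absolute liveness); each PCTL_alive rule applies only when its conclusion is not equivalent to ⊥, since unrestricted closure is inconsistent. *)

theory Defs
  imports "HOL-Probability.Probability" "HOL-Library.Sublist"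
begin

text \<open>The finite non-empty set of atomic propositions is the type \<open>'ap :: finite\<close>.\<close>

section \<open>Probabilistic trees\<close>

record 'ap ptree =
  nodes :: "nat list set"
  node_label :: "nat list \<Rightarrow> 'ap set"
  succ_dist :: "nat list \<Rightarrow> nat list pmf option"

definition edge_prob :: "'ap ptree \<Rightarrow> nat list \<Rightarrow> nat list \<Rightarrow> real" where
  "edge_prob T \<pi> \<pi>' = (case succ_dist T \<pi> of None \<Rightarrow> 0 | Some \<mu> \<Rightarrow> pmf \<mu> \<pi>')"

text \<open>
  As the empty sequence is not a node, the root of a tree is its node of length one, and there
  is exactly one such node. The functions on the nodes are extensional, so that equality of
  records is equality of trees.
\<close>

definition is_ptree :: "'ap ptree \<Rightarrow> bool" where
  "is_ptree T \<longleftrightarrow>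
     [] \<notin> nodes T \<and>
     (\<forall>\<pi>\<in>nodes T. \<forall>\<pi>'. prefix \<pi>' \<pi> \<longrightarrow> \<pi>' \<in> nodes T \<union> {[]}) \<and>
     (\<exists>!\<pi>. \<pi> \<in> nodes T \<and> length \<pi> = 1) \<and>
     node_label T \<in> extensional (nodes T) \<and>
     dom (succ_dist T) \<subseteq> nodes T \<and>
     (\<forall>\<pi> \<mu>. succ_dist T \<pi> = Some \<mu> \<longrightarrow> set_pmf \<mu> \<subseteq> nodes T) \<and>
     (\<forall>\<pi>\<in>nodes T. \<forall>\<pi>'\<in>nodes T. edge_prob T \<pi> \<pi>' > 0 \<longleftrightarrow> (\<exists>n. \<pi>' = \<pi> @ [n]))"

definition total_ptrees :: "'ap ptree set" where
  "total_ptrees = {T. is_ptree T \<and> (\<forall>\<pi>\<in>nodes T. \<exists>\<pi>'\<in>nodes T. strict_prefix \<pi> \<pi>')}"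

definition is_suffix :: "'ap ptree \<Rightarrow> 'ap ptree \<Rightarrow> bool" where
  "is_suffix T2 T1 \<longleftrightarrow>
     (\<exists>\<pi>1\<in>nodes T1.
        {\<pi>1 @ \<pi>2 | \<pi>2. \<pi>2 \<in> nodes T2} \<subseteq> nodes T1 \<and>
        (\<forall>\<pi>2\<in>nodes T2. node_label T2 \<pi>2 = node_label T1 (\<pi>1 @ \<pi>2)) \<and>
        (\<forall>\<pi>2\<in>nodes T2. \<forall>\<pi>2'\<in>nodes T2.
           edge_prob T2 \<pi>2 \<pi>2' = edge_prob T1 (\<pi>1 @ \<pi>2) (\<pi>1 @ \<pi>2')))"

definition absolute_liveness :: "'ap ptree set \<Rightarrow> bool" where
  "absolute_liveness P \<longleftrightarrow>
     P \<subseteq> total_ptrees \<and> P \<noteq> {} \<and>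
     (\<forall>T\<in>total_ptrees. \<forall>T'\<in>total_ptrees. T' \<in> P \<and> is_suffix T' T \<longrightarrow> T \<in> P)"

definition ptree_iso :: "'ap ptree \<Rightarrow> 'ap ptree \<Rightarrow> bool" where
  "ptree_iso T1 T2 \<longleftrightarrow>
     (\<exists>f. bij_betw f (nodes T1) (nodes T2) \<and>
          (\<forall>\<pi>\<in>nodes T1. \<forall>\<pi>'\<in>nodes T1. prefix (f \<pi>) (f \<pi>') \<longleftrightarrow> prefix \<pi> \<pi>') \<and>
          (\<forall>\<pi>\<in>nodes T1. node_label T2 (f \<pi>) = node_label T1 \<pi>) \<and>
          (\<forall>\<pi>\<in>nodes T1. succ_dist T2 (f \<pi>) = map_option (map_pmf f) (succ_dist T1 \<pi>)))"


section \<open>Markov chains\<close>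

record 'ap mchain =
  states :: "nat set"
  trans_dist :: "nat \<Rightarrow> nat pmf"
  state_label :: "nat \<Rightarrow> 'ap set"
  init_state :: nat

definition is_mchain :: "'ap mchain \<Rightarrow> bool" where
  "is_mchain D \<longleftrightarrow>
     init_state D \<in> states D \<and> (\<forall>s\<in>states D. set_pmf (trans_dist D s) \<subseteq> states D)"

inductive_set unfolding_nodes :: "'ap mchain \<Rightarrow> nat list set" for D :: "'ap mchain" where
  init: "[init_state D] \<in> unfolding_nodes D"
| step: "\<pi> \<in> unfolding_nodes D \<Longrightarrow> pmf (trans_dist D (last \<pi>)) t > 0 \<Longrightarrow>
           \<pi> @ [t] \<in> unfolding_nodes D"

definition unfolding_tree :: "'ap mchain \<Rightarrow> 'ap ptree" where
  "unfolding_tree D =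
     \<lparr>nodes = unfolding_nodes D,
      node_label = (\<lambda>\<pi>\<in>unfolding_nodes D. state_label D (last \<pi>)),
      succ_dist = (\<lambda>\<pi>. if \<pi> \<in> unfolding_nodes D
                     then Some (map_pmf (\<lambda>t. \<pi> @ [t]) (trans_dist D (last \<pi>)))
                     else None)\<rparr>"

text \<open>
  The distribution of the infinite runs from a state is the limit measure that the
  Ionescu-Tulcea theorem yields for the kernels below; \<open>run_measure_cylinder\<close> computes it on
  cylinder sets.
\<close>

definition run_kernel :: "'ap mchain \<Rightarrow> nat \<Rightarrow> nat \<Rightarrow> (nat \<Rightarrow> nat) \<Rightarrow> nat measure" where
  "run_kernel D s i \<omega> =
     measure_pmf (case i of 0 \<Rightarrow> return_pmf s | Suc j \<Rightarrow> trans_dist D (\<omega> j))"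

definition run_measure :: "'ap mchain \<Rightarrow> nat \<Rightarrow> (nat \<Rightarrow> nat) measure" where
  "run_measure D s =
     projective_family.lim UNIV
       (Ionescu_Tulcea.CI (run_kernel D s) (\<lambda>_. count_space UNIV)) (\<lambda>_. count_space UNIV)"

definition paths_from :: "'ap mchain \<Rightarrow> nat \<Rightarrow> (nat \<Rightarrow> nat) set" where
  "paths_from D s = {\<omega>. \<omega> 0 = s \<and> (\<forall>i. pmf (trans_dist D (\<omega> i)) (\<omega> (Suc i)) > 0)}"


section \<open>PCTL\<close>

datatype comparison = Lt | Gt | Le | Ge

primrec compare_with :: "comparison \<Rightarrow> real \<Rightarrow> real \<Rightarrow> bool" where
  "compare_with Lt x q \<longleftrightarrow> x < q"
| "compare_with Gt x q \<longleftrightarrow> x > q"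
| "compare_with Le x q \<longleftrightarrow> x \<le> q"
| "compare_with Ge x q \<longleftrightarrow> x \<ge> q"

datatype 'ap sform =
    Atom 'ap
  | Conj "'ap sform" "'ap sform"
  | Neg "'ap sform"
  | Prob comparison real "'ap pform"
and 'ap pform =
    Next "'ap sform"
  | Until "'ap sform" "'ap sform"
  | WeakUntil "'ap sform" "'ap sform"

primrec is_pctl :: "'ap sform \<Rightarrow> bool" and is_pctl_path :: "'ap pform \<Rightarrow> bool" where
  "is_pctl (Atom a) \<longleftrightarrow> True"
| "is_pctl (Conj \<Phi>1 \<Phi>2) \<longleftrightarrow> is_pctl \<Phi>1 \<and> is_pctl \<Phi>2"
| "is_pctl (Neg \<Phi>) \<longleftrightarrow> is_pctl \<Phi>"
| "is_pctl (Prob c q \<phi>) \<longleftrightarrow> 0 \<le> q \<and> q \<le> 1 \<and> is_pctl_path \<phi>"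
| "is_pctl_path (Next \<Phi>) \<longleftrightarrow> is_pctl \<Phi>"
| "is_pctl_path (Until \<Phi>1 \<Phi>2) \<longleftrightarrow> is_pctl \<Phi>1 \<and> is_pctl \<Phi>2"
| "is_pctl_path (WeakUntil \<Phi>1 \<Phi>2) \<longleftrightarrow> is_pctl \<Phi>1 \<and> is_pctl \<Phi>2"

definition Disj :: "'ap sform \<Rightarrow> 'ap sform \<Rightarrow> 'ap sform" where
  "Disj \<Phi>1 \<Phi>2 = Neg (Conj (Neg \<Phi>1) (Neg \<Phi>2))"

definition Top :: "'ap sform" where
  "Top = (let a = (SOME a. True) in Disj (Atom a) (Neg (Atom a)))"

definition Bot :: "'ap sform" where
  "Bot = Neg Top"

primrec sat :: "'ap mchain \<Rightarrow> 'ap sform \<Rightarrow> nat \<Rightarrow> bool"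
  and path_sat :: "'ap mchain \<Rightarrow> 'ap pform \<Rightarrow> (nat \<Rightarrow> nat) \<Rightarrow> bool" where
  "sat D (Atom a) s \<longleftrightarrow> a \<in> state_label D s"
| "sat D (Conj \<Phi>1 \<Phi>2) s \<longleftrightarrow> sat D \<Phi>1 s \<and> sat D \<Phi>2 s"
| "sat D (Neg \<Phi>) s \<longleftrightarrow> \<not> sat D \<Phi> s"
| "sat D (Prob c q \<phi>) s \<longleftrightarrow>
     compare_with c (measure (run_measure D s) {\<omega> \<in> paths_from D s. path_sat D \<phi> \<omega>}) q"
| "path_sat D (Next \<Phi>) \<omega> \<longleftrightarrow> sat D \<Phi> (\<omega> 1)"
| "path_sat D (Until \<Phi>1 \<Phi>2) \<omega> \<longleftrightarrow> (\<exists>j. sat D \<Phi>2 (\<omega> j) \<and> (\<forall>i<j. sat D \<Phi>1 (\<omega> i)))"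
| "path_sat D (WeakUntil \<Phi>1 \<Phi>2) \<omega> \<longleftrightarrow>
     (\<exists>j. sat D \<Phi>2 (\<omega> j) \<and> (\<forall>i<j. sat D \<Phi>1 (\<omega> i))) \<or> (\<forall>i. sat D \<Phi>1 (\<omega> i))"

definition mc_sat :: "'ap mchain \<Rightarrow> 'ap sform \<Rightarrow> bool" where
  "mc_sat D \<Phi> \<longleftrightarrow> sat D \<Phi> (init_state D)"

text \<open>
  Unfoldings are taken up to isomorphism of trees: node names carry no meaning. In an
  unfolding, nodes ending in the same number have the same label and the same successor
  probabilities, so most trees are only isomorphic to an unfolding, not equal to one.
\<close>

definition property_of :: "'ap sform \<Rightarrow> 'ap ptree set" where
  "property_of \<Phi> =
     {T \<in> total_ptrees. \<exists>D. is_mchain D \<and> mc_sat D \<Phi> \<and> ptree_iso T (unfolding_tree D)}"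

definition pctl_equiv :: "'ap sform \<Rightarrow> 'ap sform \<Rightarrow> bool" where
  "pctl_equiv \<Phi> \<Psi> \<longleftrightarrow> property_of \<Phi> = property_of \<Psi>"

text \<open>
  No formula equivalent to \<open>Bot\<close> may belong to the set. Unrestricted closure would be at odds with
  this requirement (\<open>until_sub\<close> with an unsatisfiable \<open>\<Phi>2\<close> yields an unsatisfiable formula),
  hence every rule is restricted to conclusions that are not equivalent to \<open>Bot\<close>.
\<close>

inductive_set pctl_alive :: "'ap sform set" where
  top: "Top \<in> pctl_alive"
| conj: "\<Phi>1 \<in> pctl_alive \<Longrightarrow> \<Phi>2 \<in> pctl_alive \<Longrightarrow>
    \<not> pctl_equiv (Conj \<Phi>1 \<Phi>2) Bot \<Longrightarrow> Conj \<Phi>1 \<Phi>2 \<in> pctl_alive"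
| disj: "\<Phi>1 \<in> pctl_alive \<Longrightarrow> \<Phi>2 \<in> pctl_alive \<Longrightarrow>
    \<not> pctl_equiv (Disj \<Phi>1 \<Phi>2) Bot \<Longrightarrow> Disj \<Phi>1 \<Phi>2 \<in> pctl_alive"
| weak_until: "\<Phi>1 \<in> pctl_alive \<Longrightarrow> \<Phi>2 \<in> pctl_alive \<Longrightarrow>
    \<not> pctl_equiv (Prob Gt 0 (WeakUntil \<Phi>1 \<Phi>2)) Bot \<Longrightarrow>
    Prob Gt 0 (WeakUntil \<Phi>1 \<Phi>2) \<in> pctl_alive"
| nxt: "\<Phi>2 \<in> pctl_alive \<Longrightarrow>
    \<not> pctl_equiv (Prob Gt 0 (Next \<Phi>2)) Bot \<Longrightarrow> Prob Gt 0 (Next \<Phi>2) \<in> pctl_alive"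
| until: "is_pctl \<Phi>1 \<Longrightarrow> \<Phi>2 \<in> pctl_alive \<Longrightarrow>
    \<not> pctl_equiv (Prob Gt 0 (Until \<Phi>1 \<Phi>2)) Bot \<Longrightarrow> Prob Gt 0 (Until \<Phi>1 \<Phi>2) \<in> pctl_alive"
| until_sub: "\<Phi>1 \<in> pctl_alive \<Longrightarrow> is_pctl \<Phi>2 \<Longrightarrow> pctl_equiv (Conj (Neg \<Phi>1) \<Phi>2) Bot \<Longrightarrow>
    \<not> pctl_equiv (Prob Gt 0 (Until \<Phi>1 \<Phi>2)) Bot \<Longrightarrow> Prob Gt 0 (Until \<Phi>1 \<Phi>2) \<in> pctl_alive"
| weak_until_sub: "\<Phi>1 \<in> pctl_alive \<Longrightarrow> is_pctl \<Phi>2 \<Longrightarrow> pctl_equiv (Conj (Neg \<Phi>1) \<Phi>2) Bot \<Longrightarrow>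
    \<not> pctl_equiv (Prob Gt 0 (WeakUntil \<Phi>1 \<Phi>2)) Bot \<Longrightarrow>
    Prob Gt 0 (WeakUntil \<Phi>1 \<Phi>2) \<in> pctl_alive"


section \<open>Basic facts\<close>

lemma Ionescu_Tulcea_run_kernel:
  "Ionescu_Tulcea (run_kernel D s) (\<lambda>_. count_space UNIV)"
proof (rule Ionescu_Tulcea.intro)
  fix i
  have m: "(\<lambda>x. measure_pmf (trans_dist D x)) \<in> measurable (count_space UNIV) (subprob_algebra (count_space UNIV))"
    by (auto simp: space_subprob_algebra intro: measure_pmf.subprob_space_axioms)
  show "run_kernel D s i \<in> measurable (PiM {0..<i} (\<lambda>_. count_space UNIV)) (subprob_algebra (count_space UNIV))"
  proof (cases i)
    case 0
    then show ?thesis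
      by (auto simp: run_kernel_def[abs_def] space_subprob_algebra
          intro!: measurable_const measure_pmf.subprob_space_axioms)
  next
    case (Suc j)
    have "(\<lambda>\<omega>. \<omega> j) \<in> measurable (PiM {0..<Suc j} (\<lambda>_. count_space UNIV :: nat measure)) (count_space UNIV)"
      by (rule measurable_component_singleton) simp
    from measurable_compose[OF this m] show ?thesis
      unfolding Suc by (simp add: run_kernel_def[abs_def])
  qed
next
  show "prob_space (run_kernel D s i x)" for i x
    by (simp add: run_kernel_def measure_pmf.prob_space_axioms)
qed

lemma prob_space_run_measure: "prob_space (run_measure D s)"
  and sets_run_measure: "sets (run_measure D s) = sets (PiM UNIV (\<lambda>_. count_space UNIV))"
  and run_measure_cylinder:
    "measure (run_measure D s) {\<omega>. \<forall>i\<le>n. \<omega> i = x i} =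
       (if x 0 = s then \<Prod>i<n. pmf (trans_dist D (x i)) (x (Suc i)) else 0)"
proof -
  let ?M = "\<lambda>_. count_space UNIV :: nat measure"
  let ?u = "\<lambda>_::nat. undefined :: nat"
  let ?r = "\<lambda>m. restrict x {0..<m}"
  interpret IT: Ionescu_Tulcea "run_kernel D s" ?M
    by (rule Ionescu_Tulcea_run_kernel)
  have rm: "run_measure D s = IT.PF.lim"
    by (simp add: run_measure_def)
  show sets: "sets (run_measure D s) = sets (PiM UNIV ?M)"
    by (simp add: rm)
  have u: "?u \<in> space (PiM {0..<0::nat} ?M)"
    by (simp add: space_PiM)
  have single: "{?r m} = PiE {0..<m} (\<lambda>i. {x i})" for m
    by (auto simp: PiE_iff extensional_def restrict_def fun_eq_iff)
  have single_sets: "{?r m} \<in> sets (PiM {0..<m} ?M)" for m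
    unfolding single by (intro sets_PiM_I_finite) auto
  have step: "emeasure (IT.eP m \<omega>) {?r (Suc m)} =
      emeasure (run_kernel D s m (?r m)) {x m} * indicator {?r m} \<omega>"
    if \<omega>: "\<omega> \<in> space (PiM {0..<m} ?M)" for m \<omega>
  proof -
    have ext: "\<omega> \<in> extensional {0..<m}"
      using \<omega> by (simp add: space_PiM PiE_iff)
    have iff: "fun_upd \<omega> m t = ?r (Suc m) \<longleftrightarrow> \<omega> = ?r m \<and> t = x m" for t
    proof
      assume eq: "fun_upd \<omega> m t = ?r (Suc m)"
      have "\<omega> i = ?r m i" for i
        using fun_cong[OF eq, of i] ext by (cases "i < m") (auto simp: extensional_def)
      moreover have "t = x m"
        using fun_cong[OF eq, of m] by simp
      ultimately show "\<omega> = ?r m \<and> t = x m" by blast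
    qed (auto simp: fun_eq_iff less_Suc_eq)
    have "emeasure (IT.eP m \<omega>) {?r (Suc m)} =
        emeasure (run_kernel D s m \<omega>) ((\<lambda>t. fun_upd \<omega> m t) -` {?r (Suc m)} \<inter> space (?M m))"
      by (rule IT.emeasure_eP[OF \<omega> single_sets])
    also have "(\<lambda>t. fun_upd \<omega> m t) -` {?r (Suc m)} \<inter> space (?M m) = (if \<omega> = ?r m then {x m} else {})"
      using iff by auto
    finally have e: "emeasure (IT.eP m \<omega>) {?r (Suc m)} =
        emeasure (run_kernel D s m \<omega>) (if \<omega> = ?r m then {x m} else {})" .
    show ?thesis
      unfolding e by (simp split: split_indicator)
  qed
  have C_Suc: "emeasure (IT.C 0 (Suc m) ?u) {?r (Suc m)} =
      emeasure (run_kernel D s m (?r m)) {x m} * emeasure (IT.C 0 m ?u) {?r m}" for m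
  proof -
    have sp: "space (IT.C 0 m ?u) = space (PiM {0..<m} ?M)"
      and se: "sets (IT.C 0 m ?u) = sets (PiM {0..<m} ?M)"
      using IT.space_C[OF u, of m] IT.sets_C[OF u, of m] by simp_all
    have ne: "space (IT.C 0 m ?u) \<noteq> {}"
      using prob_space.not_empty[OF IT.prob_space_C[OF u]] .
    have meas: "IT.eP m \<in> measurable (IT.C 0 m ?u) (subprob_algebra (PiM {0..<Suc m} ?M))"
      using IT.measurable_eP[of m] measurable_cong_sets[OF se refl] by blast
    have "emeasure (IT.C 0 (Suc m) ?u) {?r (Suc m)} =
        (\<integral>\<^sup>+\<omega>. emeasure (IT.eP m \<omega>) {?r (Suc m)} \<partial>IT.C 0 m ?u)"
      using emeasure_bind[OF ne meas single_sets] by simp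
    also have "\<dots> = (\<integral>\<^sup>+\<omega>. emeasure (run_kernel D s m (?r m)) {x m} * indicator {?r m} \<omega> \<partial>IT.C 0 m ?u)"
      by (intro nn_integral_cong step) (simp add: sp)
    also have "\<dots> = emeasure (run_kernel D s m (?r m)) {x m} * emeasure (IT.C 0 m ?u) {?r m}"
      using single_sets se by (intro nn_integral_cmult_indicator) simp
    finally show ?thesis .
  qed
  have C_0: "emeasure (IT.C 0 0 ?u) {?r 0} = 1"
    using single_sets[of 0] by (simp add: restrict_def)
  have C: "emeasure (IT.C 0 (Suc m) ?u) {?r (Suc m)} =
      ennreal (if x 0 = s then \<Prod>i<m. pmf (trans_dist D (x i)) (x (Suc i)) else 0)" for m
  proof (induction m)
    case 0
    show ?case
      unfolding C_Suc C_0 by (simp add: run_kernel_def emeasure_pmf_single)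
  next
    case (Suc m)
    have k: "run_kernel D s (Suc m) (?r (Suc m)) = measure_pmf (trans_dist D (x m))"
      by (simp add: run_kernel_def)
    show ?case
      unfolding C_Suc[of "Suc m"] Suc k
      by (simp add: emeasure_pmf_single ennreal_mult'' prod_nonneg mult.commute)
  qed
  have lim_C: "emeasure (run_measure D s) (prod_emb UNIV ?M {0..<m} X) = emeasure (IT.C 0 m ?u) X"
    if X: "X \<in> sets (PiM {0..<m} ?M)" for m X
  proof -
    have "emeasure (run_measure D s) (prod_emb UNIV ?M {0..<m} X) = emeasure (IT.CI {0..<m}) X"
      unfolding rm by (rule IT.lim[OF _ X]) simp
    also have "\<dots> = emeasure (IT.C 0 m ?u) (prod_emb {0..<m} ?M {0..<m} X)"
      by (rule IT.emeasure_CI[OF _ X]) simp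
    also have "prod_emb {0..<m} ?M {0..<m} X = X"
      by (rule prod_emb_id) (use sets.sets_into_space[OF X] in \<open>simp add: space_PiM\<close>)
    finally show ?thesis .
  qed
  show "prob_space (run_measure D s)"
  proof
    have sp: "space (run_measure D s) = UNIV"
      using sets_eq_imp_space_eq[OF sets] by (simp add: space_PiM)
    have "emeasure (run_measure D s) (prod_emb UNIV ?M {0..<0} {?r 0}) = 1"
      using lim_C[OF single_sets[of 0]] C_0 by simp
    moreover have "prod_emb UNIV ?M {0..<0} {?r 0} = UNIV"
      by (auto simp: prod_emb_def restrict_def)
    ultimately show "emeasure (run_measure D s) (space (run_measure D s)) = 1"
      by (simp add: sp)
  qed
  have "{\<omega>. \<forall>i\<le>n. \<omega> i = x i} = prod_emb UNIV ?M {0..<Suc n} {?r (Suc n)}"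
    by (auto simp: prod_emb_def restrict_def fun_eq_iff less_Suc_eq_le split: if_splits)
  then have "emeasure (run_measure D s) {\<omega>. \<forall>i\<le>n. \<omega> i = x i} =
      ennreal (if x 0 = s then \<Prod>i<n. pmf (trans_dist D (x i)) (x (Suc i)) else 0)"
    using lim_C[OF single_sets[of "Suc n"]] C[of n] by simp
  then show "measure (run_measure D s) {\<omega>. \<forall>i\<le>n. \<omega> i = x i} =
       (if x 0 = s then \<Prod>i<n. pmf (trans_dist D (x i)) (x (Suc i)) else 0)"
    by (simp add: measure_def prod_nonneg)
qed

lemma unfolding_tree_total: "unfolding_tree D \<in> total_ptrees"
proof -
  let ?W = "unfolding_nodes D"
  have ne: "\<pi> \<noteq> []" if "\<pi> \<in> ?W" for \<pi>
    using that by induction auto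
  have pre: "\<pi>' \<in> ?W \<union> {[]}" if "\<pi> \<in> ?W" "prefix \<pi>' \<pi>" for \<pi> \<pi>'
    using that
  proof (induction arbitrary: \<pi>')
    case init
    then show ?case by (auto simp: prefix_Cons intro: unfolding_nodes.init)
  next
    case (step \<pi> t)
    then show ?case by (auto simp: prefix_snoc intro: unfolding_nodes.step)
  qed
  have root: "\<exists>!\<pi>. \<pi> \<in> ?W \<and> length \<pi> = 1"
  proof (rule ex1I[of _ "[init_state D]"])
    show "[init_state D] \<in> ?W \<and> length [init_state D] = 1"
      by (simp add: unfolding_nodes.init)
    show "\<pi> = [init_state D]" if "\<pi> \<in> ?W \<and> length \<pi> = 1" for \<pi>
      using that[THEN conjunct1] that[THEN conjunct2] ne by cases auto
  qed
  have succ: "pmf (trans_dist D (last \<pi>)) t > 0" if "\<pi> @ [t] \<in> ?W" "\<pi> \<in> ?W" for \<pi> t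
    using that(1) by cases (use ne[OF that(2)] in auto)
  have edge: "edge_prob (unfolding_tree D) \<pi> \<pi>' > 0 \<longleftrightarrow> (\<exists>t. \<pi>' = \<pi> @ [t])"
    if W: "\<pi> \<in> ?W" "\<pi>' \<in> ?W" for \<pi> \<pi>'
  proof -
    have "edge_prob (unfolding_tree D) \<pi> \<pi>' = pmf (map_pmf (\<lambda>t. \<pi> @ [t]) (trans_dist D (last \<pi>))) \<pi>'"
      using W by (simp add: edge_prob_def unfolding_tree_def)
    then have "edge_prob (unfolding_tree D) \<pi> \<pi>' > 0 \<longleftrightarrow>
        \<pi>' \<in> (\<lambda>t. \<pi> @ [t]) ` set_pmf (trans_dist D (last \<pi>))"
      by (simp only: pmf_positive_iff[symmetric] set_map_pmf[symmetric])
    also have "\<dots> \<longleftrightarrow> (\<exists>t. \<pi>' = \<pi> @ [t])"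
      using W succ by (auto simp: pmf_positive_iff)
    finally show ?thesis .
  qed
  have tot: "\<exists>\<pi>'\<in>?W. strict_prefix \<pi> \<pi>'" if "\<pi> \<in> ?W" for \<pi>
  proof -
    obtain t where "t \<in> set_pmf (trans_dist D (last \<pi>))"
      using set_pmf_not_empty by fast
    then have "\<pi> @ [t] \<in> ?W"
      using that by (auto intro: unfolding_nodes.step simp: pmf_positive_iff)
    then show ?thesis by (auto intro!: bexI[of _ "\<pi> @ [t]"] simp: strict_prefix_def)
  qed
  have closed: "set_pmf \<mu> \<subseteq> ?W" if "succ_dist (unfolding_tree D) \<pi> = Some \<mu>" for \<pi> \<mu>
    using that by (auto simp: unfolding_tree_def intro!: unfolding_nodes.step pmf_positive split: if_splits)
  have n: "nodes (unfolding_tree D) = ?W"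
    by (simp add: unfolding_tree_def)
  show ?thesis
    unfolding total_ptrees_def is_ptree_def n mem_Collect_eq
    using ne pre root edge tot closed
    by (intro conjI) (auto simp: unfolding_tree_def split: if_splits)
qed

end

theory Submission
  imports Defs
begin

text \<open>
  A morphism of Markov chains (a map of states that preserves labels and pushes transition
  distributions forward) maps run measures to run measures, hence preserves PCTL. Every total tree
  \<open>T\<close> is itself a Markov chain whose states are its nodes; an isomorphism of \<open>T\<close> with the unfolding
  of \<open>D\<close> induces a morphism to \<open>D\<close>, and an embedding of a suffix induces a morphism between the
  chains of the two trees. So membership of \<open>T\<close> in \<open>property_of \<Phi>\<close> is satisfaction of \<open>\<Phi>\<close> at
  the root of \<open>T\<close>, and a suffix in \<open>property_of \<Phi>\<close> means that \<open>\<Phi>\<close> holds at some later node.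

  Satisfaction of a formula in \<open>pctl_alive\<close> propagates backwards along every transition, hence from
  that node to the root. Conversely, absolute liveness of \<open>\<Phi>\<close> says that \<open>\<Phi>\<close> is equivalent to
  \<open>Prob Gt 0 (Until Top \<Phi>)\<close>, which the rule \<open>until_sub\<close> with \<open>\<Phi>1 = Top\<close> puts into \<open>pctl_alive\<close>.
\<close>

section \<open>Run measures\<close>

abbreviation run_space :: "(nat \<Rightarrow> nat) measure" where
  "run_space \<equiv> PiM UNIV (\<lambda>_. count_space UNIV)"

text \<open>Lists as indices make the whole space the case \<open>[]\<close> and allow induction
  that peels off the first state.\<close>

definition list_cylinder :: "nat list \<Rightarrow> (nat \<Rightarrow> nat) set" where
  "list_cylinder l = {\<omega>. \<forall>i<length l. \<omega> i = l ! i}"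

lemma space_run_measure [simp]: "space (run_measure D s) = UNIV"
  using sets_eq_imp_space_eq[OF sets_run_measure] by (simp add: space_PiM)

declare sets_run_measure [measurable_cong]

lemma list_cylinder_Nil [simp]: "list_cylinder [] = UNIV"
  by (simp add: list_cylinder_def)

lemma sets_list_cylinder [measurable]: "list_cylinder l \<in> sets run_space"
proof -
  have "{\<omega> \<in> space run_space. \<forall>i<length l. \<omega> i = l ! i} \<in> sets run_space"
    by measurable
  then show ?thesis by (simp add: list_cylinder_def space_PiM)
qed

lemma case_nat_in_list_cylinder_Cons:
  "case_nat s \<omega> \<in> list_cylinder (a # l) \<longleftrightarrow> s = a \<and> \<omega> \<in> list_cylinder l"
  by (auto simp: list_cylinder_def less_Suc_eq_0_disj)

text \<open>Either \<open>k\<close> is a prefix of \<open>l\<close>, or the lists differ at some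
  position and no run extends both.\<close>

lemma list_cylinder_Int:
  assumes "length k \<le> length l"
  shows "list_cylinder k \<inter> list_cylinder l = {} \<or> list_cylinder k \<inter> list_cylinder l = list_cylinder l"
proof (cases "\<forall>i<length k. k ! i = l ! i")
  case True
  then show ?thesis using assms by (auto simp: list_cylinder_def)
next
  case False
  then obtain i where "i < length k" "k ! i \<noteq> l ! i" by blast
  then show ?thesis using assms by (auto simp: list_cylinder_def)
qed

text \<open>Lists are countable, so an event about coordinate \<open>i\<close> is a countable union
  of cylinders of length \<open>Suc i\<close>. The empty set joins the generator to make it closed
  under intersection.\<close>

lemma sets_run_space: "sets run_space = sigma_sets UNIV (insert {} (range list_cylinder))"
proof
  show "sigma_sets UNIV (insert {} (range list_cylinder)) \<subseteq> sets run_space"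
    using sets.sigma_sets_subset[of "insert {} (range list_cylinder)" run_space] sets_list_cylinder
    by (simp add: space_PiM image_subset_iff)
  have "{\<omega>. \<omega> i \<in> A} \<in> sigma_sets UNIV (insert {} (range list_cylinder))" for i :: nat and A
  proof -
    have "{\<omega>. \<omega> i \<in> A} = (\<Union>l\<in>{l. length l = Suc i \<and> l ! i \<in> A}. list_cylinder l)" (is "_ = ?R")
    proof (intro subset_antisym subsetI)
      fix \<omega> :: "nat \<Rightarrow> nat" assume "\<omega> \<in> {\<omega>. \<omega> i \<in> A}"
      then show "\<omega> \<in> ?R"
        by (intro UN_I[of "map \<omega> [0..<Suc i]"]) (auto simp: list_cylinder_def simp del: upt_Suc)
    qed (auto simp: list_cylinder_def)
    also have "\<dots> \<in> sigma_sets UNIV (insert {} (range list_cylinder))"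
      by (rule sigma_sets_UNION) (auto intro: sigma_sets.Basic)
    finally show ?thesis .
  qed
  then show "sets run_space \<subseteq> sigma_sets UNIV (insert {} (range list_cylinder))"
    unfolding sets_PiM_single PiE_UNIV_domain by (auto intro!: sigma_sets_mono)
qed

text \<open>Dynkin's uniqueness theorem: cylinders form an intersection-stable generator, and
  \<open>list_cylinder []\<close> already exhausts the space with finite measure.\<close>

lemma run_measure_eqI:
  assumes M: "sets M = sets run_space" and N: "sets N = sets run_space" and "finite_measure M"
    and eq: "\<And>l. emeasure M (list_cylinder l) = emeasure N (list_cylinder l)"
  shows "M = N"
proof (rule measure_eqI_generator_eq[where E = "insert {} (range list_cylinder)" and \<Omega> = UNIV
        and A = "\<lambda>_. list_cylinder []"])
  interpret finite_measure M by fact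
  have "list_cylinder k \<inter> list_cylinder l \<in> insert {} (range list_cylinder)" for k l
    using list_cylinder_Int[of k l] list_cylinder_Int[of l k]
    by (cases "length k \<le> length l") (auto simp: Int_commute)
  then show "Int_stable (insert {} (range list_cylinder))"
    unfolding Int_stable_def by blast
  show "emeasure M (list_cylinder []) \<noteq> \<infinity>" by simp
qed (use M N eq rangeI[of list_cylinder "[]"] in \<open>auto simp: sets_run_space\<close>)

lemma emeasure_run_measure_list_cylinder:
  assumes "l \<noteq> []"
  shows "emeasure (run_measure D s) (list_cylinder l) =
    ennreal (if hd l = s then \<Prod>i<length l - 1. pmf (trans_dist D (l ! i)) (l ! Suc i) else 0)"
proof -
  interpret prob_space "run_measure D s" by (rule prob_space_run_measure)
  have "list_cylinder l = {\<omega>. \<forall>i\<le>length l - 1. \<omega> i = l ! i}"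
    using assms by (auto simp: list_cylinder_def) (metis Suc_pred length_greater_0_conv less_Suc_eq_le)
  then show ?thesis
    using run_measure_cylinder[of D s "length l - 1" "\<lambda>i. l ! i"] assms
    by (simp add: emeasure_eq_measure hd_conv_nth)
qed

lemma emeasure_run_measure_list_cylinder_single:
  "emeasure (run_measure D s) (list_cylinder [a]) = (if a = s then 1 else 0)"
  by (simp add: emeasure_run_measure_list_cylinder)

lemma emeasure_run_measure_list_cylinder_Cons:
  "emeasure (run_measure D s) (list_cylinder (a # b # l)) =
    (if a = s then pmf (trans_dist D s) b * emeasure (run_measure D b) (list_cylinder (b # l)) else 0)"
  by (simp add: emeasure_run_measure_list_cylinder prod.lessThan_Suc_shift ennreal_mult' prod_nonneg
      del: prod.lessThan_Suc)

section \<open>One-step decomposition of run measures\<close>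

lemma measurable_case_nat_run_space [measurable]: "case_nat s \<in> run_space \<rightarrow>\<^sub>M run_space"
proof (rule measurable_PiM_single')
  show "(\<lambda>\<omega>. case_nat s \<omega> i) \<in> run_space \<rightarrow>\<^sub>M count_space UNIV" for i
    by (cases i) simp_all
qed (simp add: space_PiM)

lemma measurable_run_measure:
  "run_measure D \<in> measure_pmf p \<rightarrow>\<^sub>M subprob_algebra run_space"
  by (auto simp: measurable_def space_subprob_algebra sets_run_measure
      intro: prob_space_imp_subprob_space prob_space_run_measure)

text \<open>Markov property: a run from \<open>s\<close> is \<open>s\<close> followed by a run from
  a random successor. Cylinders suffice: lists with at most one entry reduce to total mass one,
  longer lists to the product formula.\<close>

lemma run_measure_step:
  "run_measure D s = measure_pmf (trans_dist D s) \<bind> (\<lambda>t. distr (run_measure D t) run_space (case_nat s))"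
  (is "_ = ?N")
proof (rule run_measure_eqI)
  interpret prob_space "run_measure D s" by (rule prob_space_run_measure)
  show "finite_measure (run_measure D s)" by (rule finite_measure_axioms)
  have k: "(\<lambda>t. distr (run_measure D t) run_space (case_nat s))
      \<in> measure_pmf (trans_dist D s) \<rightarrow>\<^sub>M subprob_algebra run_space"
    by (rule measurable_compose[OF measurable_run_measure measurable_distr]) measurable
  show "sets ?N = sets run_space"
    by (rule sets_bind) auto
  fix l
  have N: "emeasure ?N (list_cylinder l) =
      (\<integral>\<^sup>+t. emeasure (run_measure D t) {\<omega>. case_nat s \<omega> \<in> list_cylinder l} \<partial>measure_pmf (trans_dist D s))"
    by (subst emeasure_bind[OF _ k])
      (auto simp: emeasure_distr vimage_def intro!: nn_integral_cong)
  show "emeasure (run_measure D s) (list_cylinder l) = emeasure ?N (list_cylinder l)"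
  proof (cases l)
    case Nil
    have "emeasure (run_measure D t) UNIV = 1" for t
      using prob_space.emeasure_space_1[OF prob_space_run_measure, of D t] by simp
    then show ?thesis
      unfolding N by (simp add: Nil)
  next
    case (Cons a k)
    show ?thesis
    proof (cases k)
      case Nil
      have "emeasure (run_measure D t) UNIV = 1" for t
        using prob_space.emeasure_space_1[OF prob_space_run_measure, of D t] by simp
      then show ?thesis
        unfolding N unfolding Cons Nil case_nat_in_list_cylinder_Cons
        by (auto simp: emeasure_run_measure_list_cylinder_single)
    next
      case (Cons b m)
      \<comment> \<open>Only a run started in \<open>b\<close> can meet this cylinder, so the
        integral over successors collapses to the single term \<open>t = b\<close>.\<close>
      have "emeasure (run_measure D t) (list_cylinder (b # m)) =
          emeasure (run_measure D b) (list_cylinder (b # m)) * indicator {b} t" for t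
        by (auto simp: emeasure_run_measure_list_cylinder split: split_indicator)
      then have "(\<integral>\<^sup>+t. emeasure (run_measure D t) (list_cylinder (b # m)) \<partial>measure_pmf (trans_dist D s)) =
          (\<integral>\<^sup>+t. emeasure (run_measure D b) (list_cylinder (b # m)) * indicator {b} t \<partial>measure_pmf (trans_dist D s))"
        by (rule nn_integral_cong)
      also have "\<dots> = emeasure (run_measure D b) (list_cylinder (b # m)) * pmf (trans_dist D s) b"
        by (simp add: nn_integral_cmult_indicator emeasure_pmf_single)
      finally have "(\<integral>\<^sup>+t. emeasure (run_measure D t) (list_cylinder (b # m)) \<partial>measure_pmf (trans_dist D s)) =
          emeasure (run_measure D b) (list_cylinder (b # m)) * pmf (trans_dist D s) b" .
      then show ?thesis
        unfolding N unfolding \<open>l = a # k\<close> Cons case_nat_in_list_cylinder_Cons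
        by (auto simp: emeasure_run_measure_list_cylinder_Cons mult.commute)
    qed
  qed
qed (rule sets_run_measure)

lemma emeasure_run_measure_step:
  assumes [measurable]: "A \<in> sets run_space"
  shows "emeasure (run_measure D s) A =
    (\<integral>\<^sup>+t. emeasure (run_measure D t) {\<omega>. case_nat s \<omega> \<in> A} \<partial>measure_pmf (trans_dist D s))"
proof -
  have k: "(\<lambda>t. distr (run_measure D t) run_space (case_nat s))
      \<in> measure_pmf (trans_dist D s) \<rightarrow>\<^sub>M subprob_algebra run_space"
    by (rule measurable_compose[OF measurable_run_measure measurable_distr]) measurable
  show ?thesis
    by (subst run_measure_step, subst emeasure_bind[OF _ k])
      (auto simp: emeasure_distr vimage_def intro!: nn_integral_cong)
qed

text \<open>There are countably many lists, so almost every run avoids all null cylinders at once. A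
  run whose finite prefixes all have positive probability starts in \<open>s\<close> and uses only
  positive transitions.\<close>

lemma AE_run_measure_paths_from: "AE \<omega> in run_measure D s. \<omega> \<in> paths_from D s"
proof -
  have "AE \<omega> in run_measure D s. \<forall>l\<in>{l. emeasure (run_measure D s) (list_cylinder l) = 0}. \<omega> \<notin> list_cylinder l"
    by (subst AE_ball_countable)
      (auto intro!: AE_not_in simp: null_sets_def sets_run_measure)
  then show ?thesis
  proof eventually_elim
    case (elim \<omega>)
    have nz: "emeasure (run_measure D s) (list_cylinder (map \<omega> [0..<n])) \<noteq> 0" for n
    proof -
      have "\<omega> \<in> list_cylinder (map \<omega> [0..<n])" by (simp add: list_cylinder_def)
      then show ?thesis using elim by blast
    qed
    have "\<omega> 0 = s"
      using nz[of 1] by (auto simp: emeasure_run_measure_list_cylinder split: if_splits)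
    moreover have "pmf (trans_dist D (\<omega> i)) (\<omega> (Suc i)) > 0" for i
    proof -
      \<comment> \<open>The shortest prefix whose product contains the factor for the transition
        from position \<open>i\<close> to \<open>Suc i\<close>.\<close>
      let ?l = "map \<omega> [0..<Suc (Suc i)]"
      have "(\<Prod>j<length ?l - 1. pmf (trans_dist D (?l ! j)) (?l ! Suc j)) \<noteq> 0"
      proof
        assume z: "(\<Prod>j<length ?l - 1. pmf (trans_dist D (?l ! j)) (?l ! Suc j)) = 0"
        have "?l \<noteq> []" by simp
        then have "emeasure (run_measure D s) (list_cylinder ?l) = 0"
          unfolding emeasure_run_measure_list_cylinder[OF \<open>?l \<noteq> []\<close>] z by simp
        then show False using nz by blast
      qed
      then have "pmf (trans_dist D (?l ! i)) (?l ! Suc i) \<noteq> 0"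
        by (simp del: upt_Suc prod.lessThan_Suc)
      then show ?thesis by (simp add: pmf_positive_iff set_pmf_iff nth_append)
    qed
    ultimately show ?case by (simp add: paths_from_def)
  qed
qed

section \<open>Measurability and the probability operator\<close>

lemma measurable_path_sat [measurable]: "Measurable.pred run_space (path_sat D \<phi>)"
proof -
  have [measurable]: "Measurable.pred run_space (\<lambda>\<omega>. sat D \<Phi> (\<omega> i))" for \<Phi> i
    by (rule measurable_compose[of "\<lambda>\<omega>. \<omega> i" _ "count_space UNIV"]) simp_all
  have "Measurable.pred run_space (\<lambda>\<omega>. path_sat D \<phi> \<omega>)"
    by (cases \<phi>) simp_all
  then show ?thesis by simp
qed

lemma sets_path_sat [measurable]: "{\<omega>. path_sat D \<phi> \<omega>} \<in> sets run_space"
  using measurable_path_sat[of D \<phi>] by (simp add: pred_def space_PiM)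

lemma sets_paths_from [measurable]: "paths_from D s \<in> sets run_space"
proof -
  have [measurable]: "Measurable.pred run_space (\<lambda>\<omega>. pmf (trans_dist D (\<omega> i)) (\<omega> (Suc i)) > 0)" for i
  proof -
    have "(\<lambda>\<omega>. (\<omega> i, \<omega> (Suc i))) \<in> run_space \<rightarrow>\<^sub>M count_space UNIV \<Otimes>\<^sub>M count_space UNIV"
      by measurable
    then have "(\<lambda>\<omega>. (\<omega> i, \<omega> (Suc i))) \<in> run_space \<rightarrow>\<^sub>M (count_space UNIV :: (nat \<times> nat) measure)"
      by (simp add: pair_measure_countable)
    from measurable_compose[OF this, of "\<lambda>(a, b). pmf (trans_dist D a) b > 0"] show ?thesis
      by simp
  qed
  have "{\<omega> \<in> space run_space. \<omega> 0 = s \<and> (\<forall>i. pmf (trans_dist D (\<omega> i)) (\<omega> (Suc i)) > 0)} \<in> sets run_space"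
    by measurable
  then show ?thesis by (simp add: paths_from_def space_PiM)
qed

lemma measure_path_sat_paths_from:
  "measure (run_measure D s) {\<omega> \<in> paths_from D s. path_sat D \<phi> \<omega>} =
   measure (run_measure D s) {\<omega>. path_sat D \<phi> \<omega>}"
proof (rule measure_eq_AE)
  show "AE \<omega> in run_measure D s.
      (\<omega> \<in> {\<omega> \<in> paths_from D s. path_sat D \<phi> \<omega>}) = (\<omega> \<in> {\<omega>. path_sat D \<phi> \<omega>})"
    using AE_run_measure_paths_from by eventually_elim simp
  have "{\<omega> \<in> paths_from D s. path_sat D \<phi> \<omega>} = paths_from D s \<inter> {\<omega>. path_sat D \<phi> \<omega>}" by blast
  then show "{\<omega> \<in> paths_from D s. path_sat D \<phi> \<omega>} \<in> sets (run_measure D s)"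
    by (simp add: sets_run_measure sets.Int)
qed (simp add: sets_run_measure)

lemma sat_Prob:
  "sat D (Prob c q \<phi>) s \<longleftrightarrow> compare_with c (measure (run_measure D s) {\<omega>. path_sat D \<phi> \<omega>}) q"
  by (simp add: measure_path_sat_paths_from)

lemma sat_Prob_Gt_0:
  "sat D (Prob Gt 0 \<phi>) s \<longleftrightarrow> emeasure (run_measure D s) {\<omega>. path_sat D \<phi> \<omega>} > 0"
proof -
  interpret prob_space "run_measure D s" by (rule prob_space_run_measure)
  show ?thesis by (simp add: sat_Prob emeasure_eq_measure del: sat.simps)
qed

text \<open>A set of positive measure is nonempty; the intersection with \<open>paths_from\<close>
  in \<open>sat\<close> makes the witness a genuine path.\<close>

lemma sat_Prob_Gt_0_path:
  assumes "sat D (Prob Gt 0 \<phi>) s"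
  obtains \<omega> where "\<omega> \<in> paths_from D s" "path_sat D \<phi> \<omega>"
proof -
  have "{\<omega> \<in> paths_from D s. path_sat D \<phi> \<omega>} \<noteq> {}"
    using assms by (metis compare_with.simps(2) less_irrefl measure_empty sat.simps(4))
  then show ?thesis using that by blast
qed

lemma paths_from_states:
  assumes "is_mchain D" "s \<in> states D" "\<omega> \<in> paths_from D s"
  shows "\<omega> i \<in> states D"
proof (induction i)
  case (Suc i)
  then show ?case using assms by (auto simp: is_mchain_def paths_from_def pmf_positive_iff)
qed (use assms in \<open>simp add: paths_from_def\<close>)

section \<open>Morphisms of Markov chains\<close>

text \<open>A functional bisimulation. Initial states are left free, so that restarting a chain
  elsewhere is also a morphism.\<close>

definition mchain_morphism :: "(nat \<Rightarrow> nat) \<Rightarrow> 'ap mchain \<Rightarrow> 'ap mchain \<Rightarrow> bool" where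
  "mchain_morphism h E D \<longleftrightarrow>
     (\<forall>s\<in>states E. state_label D (h s) = state_label E s \<and>
        trans_dist D (h s) = map_pmf h (trans_dist E s))"

lemma measurable_comp_run_space [measurable]: "(\<lambda>\<omega>. h \<circ> \<omega>) \<in> run_space \<rightarrow>\<^sub>M run_space"
proof (rule measurable_PiM_single')
  show "(\<lambda>\<omega>. (h \<circ> \<omega>) i) \<in> run_space \<rightarrow>\<^sub>M count_space UNIV" for i
    unfolding o_def by (rule measurable_compose[of "\<lambda>\<omega>. \<omega> i" _ "count_space UNIV"]) simp_all
qed (simp add: space_PiM)

text \<open>The measures are compared on cylinders, by induction on the list with the start state
  general. Pushing the transition distribution forward turns the integral over successors in
  \<open>D\<close> into one over successors in \<open>E\<close>.\<close>

lemma run_measure_morphism: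
  assumes E: "is_mchain E" and h: "mchain_morphism h E D" and s: "s \<in> states E"
  shows "run_measure D (h s) = distr (run_measure E s) run_space (\<lambda>\<omega>. h \<circ> \<omega>)"
proof (rule run_measure_eqI)
  show "finite_measure (run_measure D (h s))"
    using prob_space_run_measure by (rule prob_space.finite_measure)
  have one: "emeasure (run_measure F t) UNIV = 1" for F :: "'a mchain" and t
    using prob_space.emeasure_space_1[OF prob_space_run_measure, of F t] by simp
  have m: "{\<omega>. h \<circ> \<omega> \<in> list_cylinder l} \<in> sets run_space" for l
    using measurable_sets[OF measurable_comp_run_space sets_list_cylinder, of h l]
    by (simp add: vimage_def space_PiM)
  have "emeasure (run_measure D (h s)) (list_cylinder l) =
      emeasure (run_measure E s) {\<omega>. h \<circ> \<omega> \<in> list_cylinder l}" for l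
    using s
  proof (induction l arbitrary: s)
    case Nil
    then show ?case by (simp add: one)
  next
    case (Cons a l)
    have cn: "h \<circ> case_nat s \<omega> = case_nat (h s) (h \<circ> \<omega>)" for \<omega>
      by (auto simp: fun_eq_iff split: nat.split)
    have tr: "trans_dist D (h s) = map_pmf h (trans_dist E s)"
      using h Cons.prems by (simp add: mchain_morphism_def)
    have "(\<integral>\<^sup>+t. emeasure (run_measure D (h t)) (list_cylinder l) \<partial>measure_pmf (trans_dist E s)) =
        (\<integral>\<^sup>+t. emeasure (run_measure E t) {\<omega>. h \<circ> \<omega> \<in> list_cylinder l} \<partial>measure_pmf (trans_dist E s))"
    \<comment> \<open>The induction hypothesis speaks of states of \<open>E\<close> only, so the
      integrands are compared just on the support, which stays inside
      \<open>states E\<close>.\<close>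
    proof (rule nn_integral_cong_AE, unfold AE_measure_pmf_iff, rule ballI)
      fix t assume "t \<in> set_pmf (trans_dist E s)"
      then have "t \<in> states E" using E Cons.prems by (auto simp: is_mchain_def)
      then show "emeasure (run_measure D (h t)) (list_cylinder l) =
          emeasure (run_measure E t) {\<omega>. h \<circ> \<omega> \<in> list_cylinder l}"
        by (rule Cons.IH)
    qed
    then have "(\<integral>\<^sup>+t. emeasure (run_measure D (h t)) {\<omega>. h s = a \<and> \<omega> \<in> list_cylinder l} \<partial>measure_pmf (trans_dist E s)) =
        (\<integral>\<^sup>+t. emeasure (run_measure E t) {\<omega>. h s = a \<and> h \<circ> \<omega> \<in> list_cylinder l} \<partial>measure_pmf (trans_dist E s))"
      by (cases "h s = a") simp_all
    then show ?case
      by (simp add: emeasure_run_measure_step[OF sets_list_cylinder, of D "h s"]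
          emeasure_run_measure_step[OF m, of E s] tr cn case_nat_in_list_cylinder_Cons del: o_apply)
  qed
  then show "emeasure (run_measure D (h s)) (list_cylinder l) =
      emeasure (distr (run_measure E s) run_space (\<lambda>\<omega>. h \<circ> \<omega>)) (list_cylinder l)" for l
    by (simp add: emeasure_distr vimage_def)
qed (simp_all add: sets_run_measure)

text \<open>Simultaneous induction on state and path formulas. In the \<open>Prob\<close> case
  almost every run is a path and hence stays in \<open>states E\<close>, where the hypothesis on
  paths applies.\<close>

lemma sat_morphism:
  assumes E: "is_mchain E" and h: "mchain_morphism h E D"
  shows "s \<in> states E \<Longrightarrow> sat D \<Phi> (h s) \<longleftrightarrow> sat E \<Phi> s"
    and "(\<And>i. \<omega> i \<in> states E) \<Longrightarrow> path_sat D \<phi> (h \<circ> \<omega>) \<longleftrightarrow> path_sat E \<phi> \<omega>"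
proof (induction \<Phi> and \<phi> arbitrary: s and \<omega>)
  case (Atom a)
  then show ?case using h by (simp add: mchain_morphism_def)
next
  case (Prob c q \<phi>)
  have "measure (run_measure D (h s)) {\<omega>. path_sat D \<phi> \<omega>} =
      measure (run_measure E s) {\<omega>. path_sat D \<phi> (h \<circ> \<omega>)}"
    unfolding run_measure_morphism[OF E h Prob.prems]
    by (subst measure_distr) (auto simp: vimage_def)
  also have "\<dots> = measure (run_measure E s) {\<omega>. path_sat E \<phi> \<omega>}"
  proof (rule measure_eq_AE)
    show "AE \<omega> in run_measure E s. (\<omega> \<in> {\<omega>. path_sat D \<phi> (h \<circ> \<omega>)}) = (\<omega> \<in> {\<omega>. path_sat E \<phi> \<omega>})"
      using AE_run_measure_paths_from
    proof eventually_elim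
      case (elim \<omega>)
      have "path_sat D \<phi> (h \<circ> \<omega>) \<longleftrightarrow> path_sat E \<phi> \<omega>"
        by (rule Prob.IH) (rule paths_from_states[OF E Prob.prems elim])
      then show ?case by simp
    qed
    show "{\<omega>. path_sat D \<phi> (h \<circ> \<omega>)} \<in> sets (run_measure E s)"
      using measurable_sets[OF measurable_comp_run_space sets_path_sat, of h D \<phi>]
      by (simp add: vimage_def space_PiM sets_run_measure)
  qed (simp add: sets_run_measure)
  finally show ?case by (simp only: sat_Prob)
qed simp_all

section \<open>Trees as Markov chains\<close>

text \<open>The values of \<open>q\<close> on the support of \<open>p\<close> already sum to one,
  which leaves \<open>q\<close> no mass elsewhere.\<close>

lemma pmf_eqI_on_support:
  assumes eq: "\<And>x. x \<in> set_pmf p \<Longrightarrow> pmf p x = pmf q x"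
  shows "p = q"
proof -
  have "measure (measure_pmf q) (set_pmf p) = infsetsum (pmf p) (set_pmf p)"
    unfolding measure_pmf_conv_infsetsum by (rule infsetsum_cong) (simp_all add: eq)
  also have "\<dots> = 1" by (rule infsetsum_pmf_eq_1) simp
  finally have "set_pmf q \<subseteq> set_pmf p"
    by (simp add: measure_pmf.prob_eq_1 AE_measure_pmf_iff subset_eq)
  then show ?thesis
    by (intro pmf_eqI) (metis eq set_pmf_iff subsetD)
qed

section \<open>The Markov chain of a tree\<close>

definition tree_root :: "'ap ptree \<Rightarrow> nat list" where
  "tree_root T = (THE \<pi>. \<pi> \<in> nodes T \<and> length \<pi> = 1)"

text \<open>States are natural numbers, so nodes are coded by \<open>to_nat\<close>. On a total tree
  every node has a successor distribution, so \<open>the\<close> is well defined there.\<close>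

definition chain_of_tree :: "'ap ptree \<Rightarrow> 'ap mchain" where
  "chain_of_tree T =
     \<lparr>states = to_nat ` nodes T,
      trans_dist = (\<lambda>s. map_pmf to_nat (the (succ_dist T (from_nat s)))),
      state_label = (\<lambda>s. node_label T (from_nat s)),
      init_state = to_nat (tree_root T)\<rparr>"

lemma chain_of_tree_simps [simp]:
  "states (chain_of_tree T) = to_nat ` nodes T"
  "trans_dist (chain_of_tree T) (to_nat \<pi>) = map_pmf to_nat (the (succ_dist T \<pi>))"
  "state_label (chain_of_tree T) (to_nat \<pi>) = node_label T \<pi>"
  "init_state (chain_of_tree T) = to_nat (tree_root T)"
  by (simp_all add: chain_of_tree_def)

lemma nodes_nonempty: "T \<in> total_ptrees \<Longrightarrow> \<pi> \<in> nodes T \<Longrightarrow> \<pi> \<noteq> []"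
  by (auto simp: total_ptrees_def is_ptree_def)

lemma nodes_prefix:
  "T \<in> total_ptrees \<Longrightarrow> \<pi> @ \<pi>' \<in> nodes T \<Longrightarrow> \<pi> \<noteq> [] \<Longrightarrow> \<pi> \<in> nodes T"
  unfolding total_ptrees_def is_ptree_def by (metis (no_types, lifting) Un_iff empty_iff insert_iff mem_Collect_eq prefixI)

lemma tree_root_unique:
  assumes "T \<in> total_ptrees"
  shows "\<pi> \<in> nodes T \<and> length \<pi> = 1 \<longleftrightarrow> \<pi> = tree_root T"
proof -
  have ex1: "\<exists>!\<pi>. \<pi> \<in> nodes T \<and> length \<pi> = 1"
    using assms by (simp add: total_ptrees_def is_ptree_def)
  show ?thesis
    using theI'[OF ex1] ex1 unfolding tree_root_def by blast
qed

lemma tree_root_in_nodes: "T \<in> total_ptrees \<Longrightarrow> tree_root T \<in> nodes T"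
  using tree_root_unique by blast

text \<open>By prefix closure the first entry of a node is itself a node of length one, hence the
  root.\<close>

lemma prefix_tree_root:
  assumes T: "T \<in> total_ptrees" and p: "\<pi> \<in> nodes T"
  shows "prefix (tree_root T) \<pi>"
proof -
  obtain n \<pi>' where \<pi>: "\<pi> = [n] @ \<pi>'"
    using nodes_nonempty[OF T p] by (cases \<pi>) auto
  then have "[n] \<in> nodes T" using nodes_prefix[OF T, of "[n]" \<pi>'] p by simp
  then have "tree_root T = [n]" using tree_root_unique[OF T, of "[n]"] by simp
  then show ?thesis using \<pi> by simp
qed

text \<open>Totality and prefix closure give a child. The edge to it has positive probability,
  whereas \<open>None\<close> would give probability zero.\<close>

lemma succ_dist_total:
  assumes T: "T \<in> total_ptrees" and p: "\<pi> \<in> nodes T"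
  obtains \<mu> where "succ_dist T \<pi> = Some \<mu>" "set_pmf \<mu> = {\<pi>'\<in>nodes T. \<exists>n. \<pi>' = \<pi> @ [n]}"
proof -
  have edge: "\<forall>\<pi>'\<in>nodes T. edge_prob T \<pi> \<pi>' > 0 \<longleftrightarrow> (\<exists>n. \<pi>' = \<pi> @ [n])"
    using T p by (simp add: total_ptrees_def is_ptree_def)
  have sub: "\<forall>\<mu>. succ_dist T \<pi> = Some \<mu> \<longrightarrow> set_pmf \<mu> \<subseteq> nodes T"
    using T by (simp add: total_ptrees_def is_ptree_def)
  obtain \<pi>' where "\<pi>' \<in> nodes T" "strict_prefix \<pi> \<pi>'"
    using T p by (auto simp: total_ptrees_def)
  then obtain n \<pi>'' where "\<pi>' = (\<pi> @ [n]) @ \<pi>''"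
    by (auto elim: strict_prefixE')
  then have "\<pi> @ [n] \<in> nodes T"
    using nodes_prefix[OF T] \<open>\<pi>' \<in> nodes T\<close> by blast
  then have "edge_prob T \<pi> (\<pi> @ [n]) > 0" using edge by blast
  then obtain \<mu> where \<mu>: "succ_dist T \<pi> = Some \<mu>"
    by (auto simp: edge_prob_def split: option.splits)
  then have "set_pmf \<mu> = {\<pi>'\<in>nodes T. \<exists>n. \<pi>' = \<pi> @ [n]}"
    using sub edge by (auto simp: edge_prob_def pmf_positive_iff)
  with \<mu> show ?thesis by (rule that)
qed

lemma chain_of_tree_step:
  assumes T: "T \<in> total_ptrees" and p: "\<pi> \<in> nodes T"
  shows "pmf (trans_dist (chain_of_tree T) (to_nat \<pi>)) t > 0 \<longleftrightarrow>
    (\<exists>n. t = to_nat (\<pi> @ [n]) \<and> \<pi> @ [n] \<in> nodes T)"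
  by (rule succ_dist_total[OF T p]) (auto simp: pmf_positive_iff)

lemma is_mchain_chain_of_tree:
  assumes T: "T \<in> total_ptrees"
  shows "is_mchain (chain_of_tree T)"
  unfolding is_mchain_def using tree_root_in_nodes[OF T] chain_of_tree_step[OF T]
  by (auto simp: pmf_positive_iff[symmetric] simp del: chain_of_tree_simps(2))

section \<open>The unfolding of the chain of a tree\<close>

definition node_path :: "nat list \<Rightarrow> nat list" where
  "node_path \<pi> = map (\<lambda>k. to_nat (take (Suc k) \<pi>)) [0..<length \<pi>]"

lemma node_path_snoc: "node_path (\<pi> @ [n]) = node_path \<pi> @ [to_nat (\<pi> @ [n])]"
  by (simp add: node_path_def)

lemma last_node_path: "\<pi> \<noteq> [] \<Longrightarrow> last (node_path \<pi>) = to_nat \<pi>"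
  by (cases \<pi> rule: rev_cases) (simp_all add: node_path_snoc)

text \<open>The last entry of \<open>node_path \<pi>\<close> codes all of \<open>\<pi>\<close>, so
  agreement at that one position recovers \<open>\<pi>\<close> as an initial segment of
  \<open>\<pi>'\<close>.\<close>

lemma prefix_node_path:
  assumes "\<pi> \<noteq> []"
  shows "prefix (node_path \<pi>) (node_path \<pi>') \<longleftrightarrow> prefix \<pi> \<pi>'"
proof
  assume pre: "prefix (node_path \<pi>) (node_path \<pi>')"
  have len: "length \<pi> \<le> length \<pi>'"
    using prefix_length_le[OF pre] by (simp add: node_path_def)
  have "node_path \<pi> ! (length \<pi> - 1) = node_path \<pi>' ! (length \<pi> - 1)"
    using pre assms by (auto simp: prefix_def nth_append node_path_def)
  moreover have "length \<pi> - 1 < length \<pi>'"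
    using assms len by (cases \<pi>) auto
  ultimately have "\<pi> = take (length \<pi>) \<pi>'"
    using assms by (simp add: node_path_def)
  then show "prefix \<pi> \<pi>'" by (metis take_is_prefix)
next
  assume "prefix \<pi> \<pi>'"
  then obtain \<rho> where "\<pi>' = \<pi> @ \<rho>" by (auto simp: prefix_def)
  then have "node_path \<pi> = take (length \<pi>) (node_path \<pi>')"
    by (intro nth_equalityI) (auto simp: node_path_def)
  then show "prefix (node_path \<pi>) (node_path \<pi>')" by (metis take_is_prefix)
qed

text \<open>A node of the unfolding lists the states visited on the way from the root, here the
  codes of the nonempty prefixes of a tree node. Both sides start at the root and grow by appending
  children.\<close>

lemma unfolding_nodes_chain_of_tree:
  assumes T: "T \<in> total_ptrees"
  shows "unfolding_nodes (chain_of_tree T) = node_path ` nodes T"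
proof (intro subset_antisym subsetI)
  fix \<rho> assume "\<rho> \<in> unfolding_nodes (chain_of_tree T)"
  then show "\<rho> \<in> node_path ` nodes T"
  proof induction
    case init
    have "length (tree_root T) = 1" using tree_root_unique[OF T] by blast
    then have "[init_state (chain_of_tree T)] = node_path (tree_root T)"
      by (simp add: node_path_def)
    then show ?case using tree_root_in_nodes[OF T] by blast
  next
    case (step \<rho> t)
    then obtain \<pi> where \<pi>: "\<pi> \<in> nodes T" "\<rho> = node_path \<pi>" by blast
    with step chain_of_tree_step[OF T \<pi>(1), of t] nodes_nonempty[OF T \<pi>(1)]
    obtain n where "t = to_nat (\<pi> @ [n])" "\<pi> @ [n] \<in> nodes T"
      by (auto simp: last_node_path simp del: chain_of_tree_simps(2))
    then show ?case using \<pi> by (metis node_path_snoc image_eqI)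
  qed
next
  have *: "\<pi> \<in> nodes T \<Longrightarrow> node_path \<pi> \<in> unfolding_nodes (chain_of_tree T)" for \<pi>
  proof (induction \<pi> rule: rev_induct)
    case Nil
    then show ?case using nodes_nonempty[OF T] by blast
  next
    case (snoc n \<pi>)
    show ?case
    proof (cases "\<pi> = []")
      case True
      then have "tree_root T = [n]"
        using snoc.prems tree_root_unique[OF T, of "[n]"] by simp
      then show ?thesis
        using True unfolding_nodes.init[of "chain_of_tree T"] by (simp add: node_path_def)
    next
      case False
      then have \<pi>: "\<pi> \<in> nodes T" using nodes_prefix[OF T snoc.prems] by blast
      have "pmf (trans_dist (chain_of_tree T) (to_nat \<pi>)) (to_nat (\<pi> @ [n])) > 0"
        using chain_of_tree_step[OF T \<pi>] snoc.prems by blast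
      then show ?thesis
        unfolding node_path_snoc using snoc.IH[OF \<pi>]
        by (intro unfolding_nodes.step) (simp_all only: last_node_path[OF False])
    qed
  qed
  fix \<rho> assume "\<rho> \<in> node_path ` nodes T"
  then show "\<rho> \<in> unfolding_nodes (chain_of_tree T)" using * by blast
qed

lemma ptree_iso_chain_of_tree:
  assumes T: "T \<in> total_ptrees"
  shows "ptree_iso T (unfolding_tree (chain_of_tree T))"
  unfolding ptree_iso_def
proof (intro exI[of _ node_path] conjI ballI)
  have "inj_on node_path (nodes T)"
    by (rule inj_onI) (metis last_node_path nodes_nonempty[OF T] from_nat_to_nat)
  then show "bij_betw node_path (nodes T) (nodes (unfolding_tree (chain_of_tree T)))"
    by (simp add: bij_betw_def unfolding_tree_def unfolding_nodes_chain_of_tree[OF T])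
  fix \<pi> assume \<pi>: "\<pi> \<in> nodes T"
  note ne = nodes_nonempty[OF T \<pi>]
  have in_unf: "node_path \<pi> \<in> unfolding_nodes (chain_of_tree T)"
    using \<pi> by (simp add: unfolding_nodes_chain_of_tree[OF T])
  show "prefix (node_path \<pi>) (node_path \<pi>') = prefix \<pi> \<pi>'" for \<pi>'
    by (rule prefix_node_path[OF ne])
  show "node_label (unfolding_tree (chain_of_tree T)) (node_path \<pi>) = node_label T \<pi>"
    using in_unf by (simp add: unfolding_tree_def last_node_path[OF ne])
  obtain \<mu> where \<mu>: "succ_dist T \<pi> = Some \<mu>" "set_pmf \<mu> = {\<pi>'\<in>nodes T. \<exists>n. \<pi>' = \<pi> @ [n]}"
    using succ_dist_total[OF T \<pi>] .
  \<comment> \<open>The support of \<open>\<mu>\<close> consists of children of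
    \<open>\<pi>\<close>, and for a child appending its code yields its
    \<open>node_path\<close>.\<close>
  have "map_pmf (\<lambda>x. node_path \<pi> @ [to_nat x]) \<mu> = map_pmf node_path \<mu>"
    using \<mu>(2) by (intro map_pmf_cong) (auto simp: node_path_snoc)
  then show "succ_dist (unfolding_tree (chain_of_tree T)) (node_path \<pi>) =
      map_option (map_pmf node_path) (succ_dist T \<pi>)"
    using in_unf by (simp add: unfolding_tree_def last_node_path[OF ne] \<mu>(1) map_pmf_comp)
qed

text \<open>Sending a node to the last state of its image under the isomorphism is a morphism to
  \<open>D\<close>. Hence all chains unfolding to \<open>T\<close> agree on every formula at their
  initial states.\<close>

lemma mc_sat_chain_of_tree:
  assumes T: "T \<in> total_ptrees" and iso: "ptree_iso T (unfolding_tree D)"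
  shows "mc_sat (chain_of_tree T) \<Phi> \<longleftrightarrow> mc_sat D \<Phi>"
proof -
  let ?U = "unfolding_tree D"
  obtain f where bij: "bij_betw f (nodes T) (nodes ?U)"
    and pre: "\<And>\<pi> \<pi>'. \<pi> \<in> nodes T \<Longrightarrow> \<pi>' \<in> nodes T \<Longrightarrow> prefix (f \<pi>) (f \<pi>') \<longleftrightarrow> prefix \<pi> \<pi>'"
    and lab: "\<And>\<pi>. \<pi> \<in> nodes T \<Longrightarrow> node_label ?U (f \<pi>) = node_label T \<pi>"
    and suc: "\<And>\<pi>. \<pi> \<in> nodes T \<Longrightarrow> succ_dist ?U (f \<pi>) = map_option (map_pmf f) (succ_dist T \<pi>)"
    using iso unfolding ptree_iso_def by blast
  have U: "?U \<in> total_ptrees" by (rule unfolding_tree_total)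
  have f_in: "f \<pi> \<in> unfolding_nodes D" if "\<pi> \<in> nodes T" for \<pi>
    using bij that by (auto simp: bij_betw_def unfolding_tree_def)
  let ?h = "\<lambda>s. last (f (from_nat s))"
  have "mchain_morphism ?h (chain_of_tree T) D"
    unfolding mchain_morphism_def
  proof (intro ballI)
    fix s assume "s \<in> states (chain_of_tree T)"
    then obtain \<pi> where \<pi>: "\<pi> \<in> nodes T" "s = to_nat \<pi>" by auto
    obtain \<mu> where \<mu>: "succ_dist T \<pi> = Some \<mu>"
      using succ_dist_total[OF T \<pi>(1)] by blast
    have "map_pmf (\<lambda>t. f \<pi> @ [t]) (trans_dist D (last (f \<pi>))) = map_pmf f \<mu>"
      using suc[OF \<pi>(1)] f_in[OF \<pi>(1)] \<mu> by (simp add: unfolding_tree_def)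
    \<comment> \<open>Projecting to last states strips \<open>f \<pi>\<close> from the left side and
      leaves the transition distribution of \<open>D\<close>.\<close>
    then have "map_pmf last (map_pmf (\<lambda>t. f \<pi> @ [t]) (trans_dist D (last (f \<pi>)))) = map_pmf last (map_pmf f \<mu>)"
      by simp
    then have "trans_dist D (last (f \<pi>)) = map_pmf (\<lambda>\<pi>. last (f \<pi>)) \<mu>"
      by (simp add: map_pmf_comp)
    then show "state_label D (?h s) = state_label (chain_of_tree T) s \<and>
        trans_dist D (?h s) = map_pmf ?h (trans_dist (chain_of_tree T) s)"
      using lab[OF \<pi>(1)] f_in[OF \<pi>(1)] \<pi>(2) \<mu> by (simp add: unfolding_tree_def map_pmf_comp)
  qed
  from sat_morphism(1)[OF is_mchain_chain_of_tree[OF T] this, of "to_nat (tree_root T)" \<Phi>]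
  have "sat (chain_of_tree T) \<Phi> (to_nat (tree_root T)) \<longleftrightarrow> sat D \<Phi> (last (f (tree_root T)))"
    using tree_root_in_nodes[OF T] by simp
  \<comment> \<open>The root is a prefix of every node and \<open>f\<close> preserves prefixes, so
    its image is a nonempty prefix of a one-element list.\<close>
  moreover have "f (tree_root T) = [init_state D]"
  proof -
    have "[init_state D] \<in> nodes ?U" by (simp add: unfolding_tree_def unfolding_nodes.init)
    then obtain \<pi> where \<pi>: "\<pi> \<in> nodes T" "[init_state D] = f \<pi>"
      using bij by (auto simp: bij_betw_def)
    then have "prefix (f (tree_root T)) [init_state D]"
      using pre[OF tree_root_in_nodes[OF T] \<pi>(1)] prefix_tree_root[OF T \<pi>(1)] by simp
    moreover have "f (tree_root T) \<noteq> []"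
      using nodes_nonempty[OF U, of "f (tree_root T)"] f_in[OF tree_root_in_nodes[OF T]]
      by (simp add: unfolding_tree_def)
    ultimately show ?thesis by (simp add: prefix_Cons)
  qed
  ultimately show ?thesis by (simp add: mc_sat_def)
qed

text \<open>Eliminates the quantifier over chains: \<open>chain_of_tree T\<close> unfolds to
  \<open>T\<close> up to isomorphism and decides formulas for every other such chain.\<close>

lemma property_of_iff:
  "T \<in> property_of \<Phi> \<longleftrightarrow> T \<in> total_ptrees \<and> mc_sat (chain_of_tree T) \<Phi>"
  using mc_sat_chain_of_tree ptree_iso_chain_of_tree is_mchain_chain_of_tree
  unfolding property_of_def by blast

lemma ptree_iso_refl: "ptree_iso T T"
  unfolding ptree_iso_def by (intro exI[of _ id]) (simp add: option.map_id)

lemma unfolding_tree_in_property_of: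
  "unfolding_tree D \<in> property_of \<Phi> \<longleftrightarrow> mc_sat D \<Phi>"
  by (simp add: property_of_iff unfolding_tree_total
      mc_sat_chain_of_tree[OF unfolding_tree_total ptree_iso_refl])

text \<open>Prepending \<open>\<rho>\<close> is a morphism between the chains of the two
  trees.\<close>

lemma sat_chain_of_tree_suffix:
  assumes T: "T \<in> total_ptrees" and T': "T' \<in> total_ptrees"
    and sub: "\<And>\<pi>. \<pi> \<in> nodes T' \<Longrightarrow> \<rho> @ \<pi> \<in> nodes T"
    and lab: "\<And>\<pi>. \<pi> \<in> nodes T' \<Longrightarrow> node_label T' \<pi> = node_label T (\<rho> @ \<pi>)"
    and edge: "\<And>\<pi> \<pi>'. \<pi> \<in> nodes T' \<Longrightarrow> \<pi>' \<in> nodes T' \<Longrightarrow>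
      edge_prob T' \<pi> \<pi>' = edge_prob T (\<rho> @ \<pi>) (\<rho> @ \<pi>')"
    and \<pi>: "\<pi> \<in> nodes T'"
  shows "sat (chain_of_tree T) \<Phi> (to_nat (\<rho> @ \<pi>)) \<longleftrightarrow> sat (chain_of_tree T') \<Phi> (to_nat \<pi>)"
proof -
  let ?h = "\<lambda>s. to_nat (\<rho> @ from_nat s)"
  have "mchain_morphism ?h (chain_of_tree T') (chain_of_tree T)"
    unfolding mchain_morphism_def
  proof (intro ballI)
    fix s assume "s \<in> states (chain_of_tree T')"
    then obtain \<sigma> where \<sigma>: "\<sigma> \<in> nodes T'" "s = to_nat \<sigma>" by auto
    obtain \<mu>' where \<mu>': "succ_dist T' \<sigma> = Some \<mu>'" "set_pmf \<mu>' = {\<pi>'\<in>nodes T'. \<exists>n. \<pi>' = \<sigma> @ [n]}"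
      using succ_dist_total[OF T' \<sigma>(1)] .
    obtain \<mu> where \<mu>: "succ_dist T (\<rho> @ \<sigma>) = Some \<mu>"
      using succ_dist_total[OF T sub[OF \<sigma>(1)]] by blast
    have inj: "inj ((@) \<rho>)" by (simp add: inj_def)
    \<comment> \<open>The suffix condition compares probabilities only between nodes of
      \<open>T'\<close>. These already carry mass one, so \<open>\<rho> @ \<sigma>\<close> has no
      further children in \<open>T\<close>.\<close>
    have "map_pmf ((@) \<rho>) \<mu>' = \<mu>"
    proof (rule pmf_eqI_on_support)
      fix x assume "x \<in> set_pmf (map_pmf ((@) \<rho>) \<mu>')"
      then obtain \<pi>' where "\<pi>' \<in> nodes T'" "x = \<rho> @ \<pi>'" using \<mu>'(2) by auto
      then show "pmf (map_pmf ((@) \<rho>) \<mu>') x = pmf \<mu> x"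
        using edge[OF \<sigma>(1)] \<mu> \<mu>'(1) by (simp add: edge_prob_def pmf_map_inj'[OF inj])
    qed
    then show "state_label (chain_of_tree T) (?h s) = state_label (chain_of_tree T') s \<and>
        trans_dist (chain_of_tree T) (?h s) = map_pmf ?h (trans_dist (chain_of_tree T') s)"
      using \<sigma> lab[OF \<sigma>(1)] \<mu> \<mu>'(1) by (auto simp: map_pmf_comp)
  qed
  from sat_morphism(1)[OF is_mchain_chain_of_tree[OF T'] this, of "to_nat \<pi>"] \<pi>
  show ?thesis by simp
qed

section \<open>Absolute liveness\<close>

lemma sat_Disj [simp]: "sat D (Disj \<Phi>1 \<Phi>2) s \<longleftrightarrow> sat D \<Phi>1 s \<or> sat D \<Phi>2 s"
  by (simp add: Disj_def)

lemma sat_Top [simp]: "sat D Top s"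
  by (simp add: Top_def Let_def)

lemma sat_Bot [simp]: "\<not> sat D Bot s"
  by (simp add: Bot_def)

lemma property_of_Bot [simp]: "property_of Bot = {}"
  by (auto simp: property_of_def mc_sat_def)

lemma sat_init_state_update:
  assumes "is_mchain D" "s \<in> states D"
  shows "mc_sat (D\<lparr>init_state := s\<rparr>) \<Phi> \<longleftrightarrow> sat D \<Phi> s"
proof -
  have "mchain_morphism id D (D\<lparr>init_state := s\<rparr>)"
    by (simp add: mchain_morphism_def)
  from sat_morphism(1)[OF assms(1) this assms(2)] show ?thesis by (simp add: mc_sat_def)
qed

text \<open>Equivalence speaks of initial states only. Restarting the chain at \<open>s\<close>
  would put its unfolding into the empty property of \<open>Bot\<close>.\<close>

lemma pctl_equiv_BotD:
  assumes "pctl_equiv \<Phi> Bot" "is_mchain D" "s \<in> states D"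
  shows "\<not> sat D \<Phi> s"
  using assms unfolding_tree_in_property_of[of "D\<lparr>init_state := s\<rparr>" \<Phi>]
  by (simp add: pctl_equiv_def sat_init_state_update)

text \<open>The counterpart of absolute liveness for a single chain.\<close>

definition backward_closed :: "'ap mchain \<Rightarrow> 'ap sform \<Rightarrow> bool" where
  "backward_closed D \<Phi> \<longleftrightarrow>
     (\<forall>s\<in>states D. \<forall>t\<in>set_pmf (trans_dist D s). sat D \<Phi> t \<longrightarrow> sat D \<Phi> s)"

section \<open>Path formulas of positive probability\<close>

lemma sat_Prob_Gt_0_all_paths:
  assumes "\<And>\<omega>. \<omega> \<in> paths_from D s \<Longrightarrow> path_sat D \<phi> \<omega>"
  shows "sat D (Prob Gt 0 \<phi>) s"
proof -
  interpret prob_space "run_measure D s" by (rule prob_space_run_measure)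
  have "AE \<omega> in run_measure D s. \<omega> \<in> {\<omega>. path_sat D \<phi> \<omega>}"
    using AE_run_measure_paths_from by eventually_elim (simp add: assms)
  then have "measure (run_measure D s) {\<omega>. path_sat D \<phi> \<omega>} = 1"
    by (subst prob_eq_1) (simp_all add: sets_run_measure)
  then show ?thesis by (simp add: sat_Prob del: sat.simps)
qed

lemma sat_Prob_Gt_0_Next:
  assumes t: "t \<in> set_pmf (trans_dist D s)" and sat: "sat D \<Phi> t"
  shows "sat D (Prob Gt 0 (Next \<Phi>)) s"
proof -
  have "0 < emeasure (run_measure D s) (list_cylinder [s, t])"
    using t by (simp add: emeasure_run_measure_list_cylinder pmf_positive)
  also have "\<dots> \<le> emeasure (run_measure D s) {\<omega>. path_sat D (Next \<Phi>) \<omega>}"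
  proof (rule emeasure_mono)
    show "list_cylinder [s, t] \<subseteq> {\<omega>. path_sat D (Next \<Phi>) \<omega>}"
      using sat by (auto simp: list_cylinder_def)
    show "{\<omega>. path_sat D (Next \<Phi>) \<omega>} \<in> sets (run_measure D s)"
      unfolding sets_run_measure by (rule sets_path_sat)
  qed
  finally show ?thesis by (simp only: sat_Prob_Gt_0)
qed

text \<open>In the one-step decomposition at \<open>s\<close>, the successor \<open>t\<close> has
  positive weight and contributes a positive measure of runs that still satisfy
  \<open>\<phi>\<close> after \<open>s\<close> is prepended.\<close>

lemma sat_Prob_Gt_0_step:
  assumes t: "t \<in> set_pmf (trans_dist D s)" and sat: "sat D (Prob Gt 0 \<phi>) t"
    and step: "\<And>\<omega>. path_sat D \<phi> \<omega> \<Longrightarrow> path_sat D \<phi> (case_nat s \<omega>)"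
  shows "sat D (Prob Gt 0 \<phi>) s"
proof -
  have m: "{\<omega>. path_sat D \<phi> (case_nat s \<omega>)} \<in> sets run_space"
    using measurable_sets[OF measurable_case_nat_run_space sets_path_sat, of s D \<phi>]
    by (simp add: vimage_def space_PiM)
  have "0 < emeasure (run_measure D t) {\<omega>. path_sat D \<phi> \<omega>}"
    using sat by (simp only: sat_Prob_Gt_0)
  also have "\<dots> \<le> emeasure (run_measure D t) {\<omega>. path_sat D \<phi> (case_nat s \<omega>)}"
    using step m by (intro emeasure_mono) (auto simp: sets_run_measure)
  finally have "(\<integral>\<^sup>+t. emeasure (run_measure D t) {\<omega>. path_sat D \<phi> (case_nat s \<omega>)}
      \<partial>measure_pmf (trans_dist D s)) \<noteq> 0"
    using t by (auto simp: nn_integral_0_iff_AE AE_measure_pmf_iff zero_less_iff_neq_zero)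
  then show ?thesis
    unfolding sat_Prob_Gt_0 by (subst emeasure_run_measure_step) (simp_all add: zero_less_iff_neq_zero)
qed

lemma path_sat_Until_step:
  assumes "sat D \<Phi>1 s" "path_sat D (Until \<Phi>1 \<Phi>2) \<omega>"
  shows "path_sat D (Until \<Phi>1 \<Phi>2) (case_nat s \<omega>)"
proof -
  obtain j where "sat D \<Phi>2 (\<omega> j)" "\<forall>i<j. sat D \<Phi>1 (\<omega> i)" using assms(2) by auto
  then show ?thesis
    using assms(1) by (auto intro!: exI[of _ "Suc j"] simp: less_Suc_eq_0_disj)
qed

lemma path_sat_WeakUntil_iff:
  "path_sat D (WeakUntil \<Phi>1 \<Phi>2) \<omega> \<longleftrightarrow> path_sat D (Until \<Phi>1 \<Phi>2) \<omega> \<or> (\<forall>i. sat D \<Phi>1 (\<omega> i))"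
  by simp

lemma path_sat_WeakUntil_step:
  assumes "sat D \<Phi>1 s" "path_sat D (WeakUntil \<Phi>1 \<Phi>2) \<omega>"
  shows "path_sat D (WeakUntil \<Phi>1 \<Phi>2) (case_nat s \<omega>)"
  using assms(2) path_sat_Until_step[OF assms(1)] assms(1)
  unfolding path_sat_WeakUntil_iff by (auto split: nat.split simp del: path_sat.simps)

lemma path_sat_Until_start: "path_sat D (Until \<Phi>1 \<Phi>2) \<omega> \<Longrightarrow> sat D \<Phi>1 (\<omega> 0) \<or> sat D \<Phi>2 (\<omega> 0)"
  by simp (metis gr0I)

lemma sat_Prob_Gt_0_Until_start:
  assumes "sat D (Prob Gt 0 (Until \<Phi>1 \<Phi>2)) s"
  shows "sat D \<Phi>1 s \<or> sat D \<Phi>2 s"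
proof -
  obtain \<omega> where "\<omega> \<in> paths_from D s" "path_sat D (Until \<Phi>1 \<Phi>2) \<omega>"
    using sat_Prob_Gt_0_path[OF assms] .
  then show ?thesis using path_sat_Until_start[of D \<Phi>1 \<Phi>2 \<omega>] unfolding paths_from_def by simp
qed

lemma sat_Prob_Gt_0_WeakUntil_start:
  assumes "sat D (Prob Gt 0 (WeakUntil \<Phi>1 \<Phi>2)) s"
  shows "sat D \<Phi>1 s \<or> sat D \<Phi>2 s"
proof -
  obtain \<omega> where \<omega>: "\<omega> \<in> paths_from D s" "path_sat D (WeakUntil \<Phi>1 \<Phi>2) \<omega>"
    using sat_Prob_Gt_0_path[OF assms] .
  then have "sat D \<Phi>1 (\<omega> 0) \<or> sat D \<Phi>2 (\<omega> 0)"
    using path_sat_Until_start[of D \<Phi>1 \<Phi>2 \<omega>] unfolding path_sat_WeakUntil_iff by blast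
  then show ?thesis using \<omega>(1) unfolding paths_from_def by simp
qed

lemma sat_Prob_Gt_0_Until_now: "sat D \<Phi>2 s \<Longrightarrow> sat D (Prob Gt 0 (Until \<Phi>1 \<Phi>2)) s"
  by (rule sat_Prob_Gt_0_all_paths) (auto simp: paths_from_def intro!: exI[of _ 0])

lemma sat_Prob_Gt_0_WeakUntil_now: "sat D \<Phi>2 s \<Longrightarrow> sat D (Prob Gt 0 (WeakUntil \<Phi>1 \<Phi>2)) s"
  by (rule sat_Prob_Gt_0_all_paths) (auto simp: paths_from_def intro!: exI[of _ 0])

section \<open>Backward closure of alive formulas\<close>

lemma backward_closed_path:
  assumes D: "is_mchain D" "s \<in> states D" and "backward_closed D \<Phi>"
    and \<omega>: "\<omega> \<in> paths_from D s" and "sat D \<Phi> (\<omega> j)"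
  shows "sat D \<Phi> s"
  using assms(5)
proof (induction j)
  case 0
  then show ?case using \<omega> by (simp add: paths_from_def)
next
  case (Suc j)
  have "\<omega> (Suc j) \<in> set_pmf (trans_dist D (\<omega> j))"
    using \<omega> by (simp add: paths_from_def pmf_positive_iff)
  then show ?case
    using Suc assms(3) paths_from_states[OF D \<omega>] by (auto simp: backward_closed_def)
qed

text \<open>Rule induction. For \<open>nxt\<close> and \<open>until\<close>, a later state with
  \<open>\<Phi>2\<close> is pulled back along the path. For the other temporal rules,
  \<open>\<Phi>1\<close> at \<open>s\<close> allows \<open>s\<close> to be prepended to the
  satisfying runs from \<open>t\<close>.\<close>

lemma pctl_alive_backward_closed:
  assumes "\<Phi> \<in> pctl_alive" and D: "is_mchain D"
  shows "backward_closed D \<Phi>"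
  using assms(1)
proof induction
  case (weak_until \<Phi>1 \<Phi>2)
  show ?case
    unfolding backward_closed_def
  proof (intro ballI impI)
    fix s t assume s: "s \<in> states D" and t: "t \<in> set_pmf (trans_dist D s)"
      and sat: "sat D (Prob Gt 0 (WeakUntil \<Phi>1 \<Phi>2)) t"
    \<comment> \<open>The formula forces \<open>\<Phi>1\<close> or \<open>\<Phi>2\<close> at
      \<open>t\<close>, and both are backward closed. At \<open>s\<close> the first permits
      prepending, the second fulfils the formula at once.\<close>
    have "sat D \<Phi>1 s \<or> sat D \<Phi>2 s"
      using sat_Prob_Gt_0_WeakUntil_start[OF sat] weak_until.IH s t
      unfolding backward_closed_def by blast
    then show "sat D (Prob Gt 0 (WeakUntil \<Phi>1 \<Phi>2)) s"
      using sat_Prob_Gt_0_step[OF t sat] path_sat_WeakUntil_step sat_Prob_Gt_0_WeakUntil_now by blast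
  qed
next
  case (nxt \<Phi>2)
  show ?case
    unfolding backward_closed_def
  proof (intro ballI impI)
    fix s t assume s: "s \<in> states D" and t: "t \<in> set_pmf (trans_dist D s)"
      and sat: "sat D (Prob Gt 0 (Next \<Phi>2)) t"
    have ts: "t \<in> states D" using D s t by (auto simp: is_mchain_def)
    obtain \<omega> where "\<omega> \<in> paths_from D t" "path_sat D (Next \<Phi>2) \<omega>"
      using sat_Prob_Gt_0_path[OF sat] .
    then have "sat D \<Phi>2 t"
      using backward_closed_path[OF D ts nxt.IH, of \<omega> 1] by simp
    then show "sat D (Prob Gt 0 (Next \<Phi>2)) s"
      by (rule sat_Prob_Gt_0_Next[OF t])
  qed
next
  case (until \<Phi>1 \<Phi>2)
  show ?case
    unfolding backward_closed_def
  proof (intro ballI impI)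
    fix s t assume s: "s \<in> states D" and t: "t \<in> set_pmf (trans_dist D s)"
      and sat: "sat D (Prob Gt 0 (Until \<Phi>1 \<Phi>2)) t"
    have ts: "t \<in> states D" using D s t by (auto simp: is_mchain_def)
    obtain \<omega> where \<omega>: "\<omega> \<in> paths_from D t" "path_sat D (Until \<Phi>1 \<Phi>2) \<omega>"
      using sat_Prob_Gt_0_path[OF sat] .
    then obtain j where "sat D \<Phi>2 (\<omega> j)" by auto
    then have "sat D \<Phi>2 t"
      using backward_closed_path[OF D ts until.IH \<omega>(1)] by blast
    then have "sat D \<Phi>2 s" using until.IH s t by (auto simp: backward_closed_def)
    then show "sat D (Prob Gt 0 (Until \<Phi>1 \<Phi>2)) s" by (rule sat_Prob_Gt_0_Until_now)
  qed
next
  case (until_sub \<Phi>1 \<Phi>2)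
  \<comment> \<open>The side condition means that \<open>\<Phi>2\<close> implies
    \<open>\<Phi>1\<close> at every state, so the formula forces \<open>\<Phi>1\<close> at
    \<open>t\<close> in either case.\<close>
  have imp: "sat D \<Phi>1 s" if "s \<in> states D" "sat D \<Phi>2 s" for s
    using pctl_equiv_BotD[OF \<open>pctl_equiv (Conj (Neg \<Phi>1) \<Phi>2) Bot\<close> D that(1)] that(2) by simp
  show ?case
    unfolding backward_closed_def
  proof (intro ballI impI)
    fix s t assume s: "s \<in> states D" and t: "t \<in> set_pmf (trans_dist D s)"
      and sat: "sat D (Prob Gt 0 (Until \<Phi>1 \<Phi>2)) t"
    have "t \<in> states D" using D s t by (auto simp: is_mchain_def)
    then have "sat D \<Phi>1 t" using sat_Prob_Gt_0_Until_start[OF sat] imp by blast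
    then have "sat D \<Phi>1 s" using until_sub.IH s t by (auto simp: backward_closed_def)
    then show "sat D (Prob Gt 0 (Until \<Phi>1 \<Phi>2)) s"
      using sat_Prob_Gt_0_step[OF t sat] path_sat_Until_step by blast
  qed
next
  case (weak_until_sub \<Phi>1 \<Phi>2)
  have imp: "sat D \<Phi>1 s" if "s \<in> states D" "sat D \<Phi>2 s" for s
    using pctl_equiv_BotD[OF \<open>pctl_equiv (Conj (Neg \<Phi>1) \<Phi>2) Bot\<close> D that(1)] that(2) by simp
  show ?case
    unfolding backward_closed_def
  proof (intro ballI impI)
    fix s t assume s: "s \<in> states D" and t: "t \<in> set_pmf (trans_dist D s)"
      and sat: "sat D (Prob Gt 0 (WeakUntil \<Phi>1 \<Phi>2)) t"
    have "t \<in> states D" using D s t by (auto simp: is_mchain_def)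
    then have "sat D \<Phi>1 t" using sat_Prob_Gt_0_WeakUntil_start[OF sat] imp by blast
    then have "sat D \<Phi>1 s" using weak_until_sub.IH s t by (auto simp: backward_closed_def)
    then show "sat D (Prob Gt 0 (WeakUntil \<Phi>1 \<Phi>2)) s"
      using sat_Prob_Gt_0_step[OF t sat] path_sat_WeakUntil_step by blast
  qed
qed (auto simp: backward_closed_def)

text \<open>Every rule but \<open>top\<close> excludes conclusions equivalent to \<open>Bot\<close>,
  whose property is empty.\<close>

lemma property_of_pctl_alive_nonempty:
  assumes "\<Phi> \<in> pctl_alive"
  shows "property_of \<Phi> \<noteq> {}"
  using assms
proof cases
  case top
  then show ?thesis
    using unfolding_tree_in_property_of[of _ Top] by (auto simp: mc_sat_def)
qed (auto simp: pctl_equiv_def)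

text \<open>Removing the last entry of \<open>\<rho>\<close> is one transition backwards; with
  \<open>\<pi>\<close> nonempty, all intermediate sequences are nodes.\<close>

lemma backward_closed_chain_of_tree:
  assumes T: "T \<in> total_ptrees" and bc: "backward_closed (chain_of_tree T) \<Phi>" and "\<pi> \<noteq> []"
  shows "\<pi> @ \<rho> \<in> nodes T \<Longrightarrow> sat (chain_of_tree T) \<Phi> (to_nat (\<pi> @ \<rho>)) \<Longrightarrow>
    sat (chain_of_tree T) \<Phi> (to_nat \<pi>)"
proof (induction \<rho> rule: rev_induct)
  case (snoc n \<rho>)
  have "\<pi> @ \<rho> \<in> nodes T" using nodes_prefix[OF T, of "\<pi> @ \<rho>" "[n]"] snoc.prems(1) \<open>\<pi> \<noteq> []\<close> by simp
  moreover from this have "to_nat (\<pi> @ \<rho> @ [n]) \<in> set_pmf (trans_dist (chain_of_tree T) (to_nat (\<pi> @ \<rho>)))"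
    using chain_of_tree_step[OF T, of "\<pi> @ \<rho>" "to_nat (\<pi> @ \<rho> @ [n])"] snoc.prems(1)
    by (simp add: pmf_positive_iff[symmetric] del: chain_of_tree_simps(2))
  ultimately show ?case
    using snoc bc unfolding backward_closed_def by auto
qed simp

lemma absolute_liveness_pctl_alive:
  assumes \<Phi>: "\<Phi> \<in> pctl_alive"
  shows "absolute_liveness (property_of \<Phi>)"
  unfolding absolute_liveness_def
proof (intro conjI ballI impI)
  show "property_of \<Phi> \<subseteq> total_ptrees" by (auto simp: property_of_def)
  show "property_of \<Phi> \<noteq> {}" using \<Phi> by (rule property_of_pctl_alive_nonempty)
  fix T T' :: "'a ptree"
  assume T: "T \<in> total_ptrees" and T': "T' \<in> total_ptrees"
    and "T' \<in> property_of \<Phi> \<and> is_suffix T' T"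
  then obtain \<rho> where sat': "sat (chain_of_tree T') \<Phi> (to_nat (tree_root T'))"
    and sub: "{\<rho> @ \<pi> | \<pi>. \<pi> \<in> nodes T'} \<subseteq> nodes T"
    and lab: "\<forall>\<pi>\<in>nodes T'. node_label T' \<pi> = node_label T (\<rho> @ \<pi>)"
    and edge: "\<forall>\<pi>\<in>nodes T'. \<forall>\<pi>'\<in>nodes T'. edge_prob T' \<pi> \<pi>' = edge_prob T (\<rho> @ \<pi>) (\<rho> @ \<pi>')"
    by (auto simp: property_of_iff mc_sat_def is_suffix_def)
  note root' = tree_root_in_nodes[OF T']
  \<comment> \<open>The root of \<open>T'\<close> has length one, so its copy in \<open>T\<close> is
    a child of \<open>\<rho>\<close> and not \<open>\<rho>\<close> itself.\<close>
  let ?\<pi> = "\<rho> @ tree_root T'"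
  have \<pi>: "?\<pi> \<in> nodes T" using sub root' by blast
  have "sat (chain_of_tree T) \<Phi> (to_nat ?\<pi>)"
    using sat_chain_of_tree_suffix[OF T T' _ _ _ root', of \<rho>] sub lab edge sat' by blast
  moreover obtain \<sigma> where "?\<pi> = tree_root T @ \<sigma>"
    using prefix_tree_root[OF T \<pi>] by (auto simp: prefix_def)
  ultimately have "sat (chain_of_tree T) \<Phi> (to_nat (tree_root T))"
    using backward_closed_chain_of_tree[OF T
        pctl_alive_backward_closed[OF \<Phi> is_mchain_chain_of_tree[OF T]]] \<pi>
      nodes_nonempty[OF T tree_root_in_nodes[OF T]] by metis
  then show "T \<in> property_of \<Phi>" using T by (simp add: property_of_iff mc_sat_def)
qed

section \<open>Suffixes of unfoldings and the converse direction\<close>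

lemma unfolding_nodes_path:
  assumes "\<omega> \<in> paths_from D (init_state D)"
  shows "map \<omega> [0..<Suc n] \<in> unfolding_nodes D"
proof (induction n)
  case 0
  then show ?case using assms unfolding_nodes.init[of D] by (simp add: paths_from_def)
next
  case (Suc n)
  have "pmf (trans_dist D (last (map \<omega> [0..<Suc n]))) (\<omega> (Suc n)) > 0"
    using assms by (simp add: paths_from_def)
  from unfolding_nodes.step[OF Suc this] show ?case by simp
qed

text \<open>Labels and transitions depend only on the last state, which a prepended path leaves
  unchanged. The prefix stops at \<open>\<omega> n\<close> because the root of the suffix supplies
  \<open>\<omega> (Suc n)\<close>.\<close>

lemma unfolding_tree_suffix:
  assumes \<omega>: "\<omega> \<in> paths_from D (init_state D)"
  shows "is_suffix (unfolding_tree (D\<lparr>init_state := \<omega> (Suc n)\<rparr>)) (unfolding_tree D)"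
proof -
  let ?E = "D\<lparr>init_state := \<omega> (Suc n)\<rparr>"
  let ?\<rho> = "map \<omega> [0..<Suc n]"
  have ne: "\<pi> \<noteq> []" if "\<pi> \<in> unfolding_nodes ?E" for \<pi>
    using that by induction auto
  have app: "?\<rho> @ \<pi> \<in> unfolding_nodes D" if "\<pi> \<in> unfolding_nodes ?E" for \<pi>
    using that
  proof induction
    case init
    then show ?case using unfolding_nodes_path[OF \<omega>, of "Suc n"] by simp
  next
    case (step \<pi> t)
    then show ?case
      using unfolding_nodes.step[of "?\<rho> @ \<pi>" D t] ne[OF step(1)] by (simp del: upt_Suc)
  qed
  have edge: "edge_prob (unfolding_tree ?E) \<pi> \<pi>' = edge_prob (unfolding_tree D) (?\<rho> @ \<pi>) (?\<rho> @ \<pi>')"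
    if \<pi>: "\<pi> \<in> unfolding_nodes ?E" for \<pi> \<pi>'
  proof -
    have inj: "inj ((@) ?\<rho>)" by (simp add: inj_def)
    have "edge_prob (unfolding_tree D) (?\<rho> @ \<pi>) (?\<rho> @ \<pi>') =
        pmf (map_pmf ((@) ?\<rho>) (map_pmf (\<lambda>t. \<pi> @ [t]) (trans_dist D (last \<pi>)))) (?\<rho> @ \<pi>')"
      using app[OF \<pi>] ne[OF \<pi>] by (simp add: edge_prob_def unfolding_tree_def map_pmf_comp del: upt_Suc)
    also have "\<dots> = pmf (map_pmf (\<lambda>t. \<pi> @ [t]) (trans_dist D (last \<pi>))) \<pi>'"
      by (rule pmf_map_inj'[OF inj])
    finally show ?thesis using \<pi> by (simp add: edge_prob_def unfolding_tree_def)
  qed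
  have "?\<rho> \<in> nodes (unfolding_tree D)"
    using unfolding_nodes_path[OF \<omega>, of n] by (simp add: unfolding_tree_def del: upt_Suc)
  moreover have "node_label (unfolding_tree ?E) \<pi> = node_label (unfolding_tree D) (?\<rho> @ \<pi>)"
    if "\<pi> \<in> unfolding_nodes ?E" for \<pi>
    using that app[OF that] ne[OF that] by (simp add: unfolding_tree_def del: upt_Suc)
  moreover have "nodes (unfolding_tree D) = unfolding_nodes D" "nodes (unfolding_tree ?E) = unfolding_nodes ?E"
    by (simp_all add: unfolding_tree_def)
  ultimately show ?thesis
    unfolding is_suffix_def using app edge by (intro bexI[of _ ?\<rho>]) (auto simp del: upt_Suc)
qed

lemma absolute_liveness_eventually:
  assumes live: "absolute_liveness (property_of \<Phi>)" and D: "is_mchain D"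
  shows "mc_sat D (Prob Gt 0 (Until Top \<Phi>)) \<longleftrightarrow> mc_sat D \<Phi>"
proof
  assume "mc_sat D \<Phi>"
  then show "mc_sat D (Prob Gt 0 (Until Top \<Phi>))"
    unfolding mc_sat_def by (rule sat_Prob_Gt_0_Until_now)
next
  assume "mc_sat D (Prob Gt 0 (Until Top \<Phi>))"
  then obtain \<omega> where \<omega>: "\<omega> \<in> paths_from D (init_state D)" and "path_sat D (Until Top \<Phi>) \<omega>"
    unfolding mc_sat_def by (rule sat_Prob_Gt_0_path)
  then obtain j where j: "sat D \<Phi> (\<omega> j)" by auto
  \<comment> \<open>A suffix sits strictly below the root, so only positions \<open>Suc n\<close>
    are handled by liveness; position 0 is the initial state.\<close>
  show "mc_sat D \<Phi>"
  proof (cases j)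
    case 0
    then show ?thesis using j \<omega> by (simp add: mc_sat_def paths_from_def)
  next
    case (Suc n)
    let ?E = "D\<lparr>init_state := \<omega> (Suc n)\<rparr>"
    have "\<omega> (Suc n) \<in> states D"
      using D by (intro paths_from_states[OF D _ \<omega>]) (simp add: is_mchain_def)
    then have "unfolding_tree ?E \<in> property_of \<Phi>"
      using j Suc by (simp add: unfolding_tree_in_property_of sat_init_state_update[OF D])
    then have "unfolding_tree D \<in> property_of \<Phi>"
      using live unfolding_tree_suffix[OF \<omega>, of n] unfolding_tree_total
      unfolding absolute_liveness_def by blast
    then show ?thesis by (simp add: unfolding_tree_in_property_of)
  qed
qed

theorem theorem10:
  shows "(\<forall>\<Phi> \<in> (pctl_alive :: 'ap::finite sform set). absolute_liveness (property_of \<Phi>)) \<and>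
         (\<forall>\<Phi> :: 'ap sform. is_pctl \<Phi> \<and> absolute_liveness (property_of \<Phi>) \<longrightarrow>
            (\<exists>\<Phi>' \<in> pctl_alive. pctl_equiv \<Phi> \<Phi>'))"
proof (intro conjI ballI allI impI)
  show "absolute_liveness (property_of \<Phi>)" if "\<Phi> \<in> pctl_alive" for \<Phi> :: "'ap sform"
    using that by (rule absolute_liveness_pctl_alive)
next
  fix \<Phi> :: "'ap sform"
  assume \<Phi>: "is_pctl \<Phi> \<and> absolute_liveness (property_of \<Phi>)"
  let ?\<Psi> = "Prob Gt 0 (Until Top \<Phi>)"
  have eq: "property_of \<Phi> = property_of ?\<Psi>"
    unfolding property_of_def using \<Phi> absolute_liveness_eventually by blast
  \<comment> \<open>\<open>Neg Top\<close> is unsatisfiable, so \<open>until_sub\<close> accepts any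
    PCTL formula as second argument; \<open>until\<close> would demand \<open>\<Phi>\<close> to be
    alive already.\<close>
  have "pctl_equiv (Conj (Neg Top) \<Phi>) Bot"
    by (simp add: pctl_equiv_def) (simp add: property_of_def mc_sat_def)
  \<comment> \<open>Absolute liveness includes nonemptiness of the property.\<close>
  moreover have "\<not> pctl_equiv ?\<Psi> Bot"
    using \<Phi> eq by (simp add: pctl_equiv_def absolute_liveness_def)
  ultimately have "?\<Psi> \<in> pctl_alive"
    using \<Phi> by (intro pctl_alive.until_sub pctl_alive.top) simp_all
  then show "\<exists>\<Phi>'\<in>pctl_alive. pctl_equiv \<Phi> \<Phi>'"
    using eq by (auto simp: pctl_equiv_def)
qed

end
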